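(* Let $(M,\omega)$ be an $n$-dimensional Hermitian manifold ($n=\dim_{\mathbb C}M\ge 3$) and let $k$ be an integer with $1\le k\le n-1$. Then the following are equivalent: (1) $\omega$ is $k$-Gauduchon, i.e. $\sqrt{-1}\,\partial\bar\partial\omega^k\wedge\omega^{n-k-1}=0$; (2) $s-\hat s=\dfrac{k-1}{n-2}|\partial^*\omega|^2+\dfrac{n-1-k}{n-2}|\partial\omega|^2$ at every point of $M$.
   Context: Locally $\omega=\sqrt{-1}\,h_{i\bar j}dz^i\wedge d\bar z^j$. The Chern connection has Christoffel symbols $\Gamma_{ij}^k=h^{k\bar l}\partial_i h_{j\bar l}$ and curvature $R_{i\bar jk\bar l}=-h_{p\bar l}\,\partial_{\bar j}\Gamma^p_{ik}$. The two scalar curvatures are $s=h^{i\bar j}h^{k\bar l}R_{i\bar jk\bar l}$ and $\hat s=h^{i\bar l}h^{k\bar j}R_{i\bar jk\bar l}$. The pointwise Hermitian inner product on forms is determined by $\langle dz^i,dz^j\rangle=h^{i\bar j}$ (where $(h^{i\bar j})$ is the transposed inverse of $(h_{i\bar j})$) and $\langle\alpha_1\wedge\dots\wedge\alpha_k,\beta_1\wedge\dots\wedge\beta_k\rangle=\det(\langle\alpha_i,\beta_j\rangle)$; $|\varphi|^2=\langle\varphi,\varphi\rangle$; the volume form is $dv=\omega^n/n!$; the $\mathbb{C}$-linear Hodge star satisfies $\varphi\wedge*\bar\psi=\langle\varphi,\psi\rangle dv$; and $\partial^*=-*\bar\partial*$ is the formal adjoint of $\partial$. *)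

theory Defs
  imports "HOL-Analysis.Analysis"
begin

type_synonym 'n cvec = "complex^'n"
type_synonym 'n cmat = "complex^'n^'n"

section \<open>Smooth and holomorphic maps\<close>

primrec Ck_on :: "nat \<Rightarrow> ('a::real_normed_vector \<Rightarrow> 'b::real_normed_vector) \<Rightarrow> 'a set \<Rightarrow> bool" where
  "Ck_on 0 f S \<longleftrightarrow> continuous_on S f"
| "Ck_on (Suc m) f S \<longleftrightarrow>
     (\<forall>x\<in>S. f differentiable (at x)) \<and> (\<forall>v. Ck_on m (\<lambda>x. frechet_derivative f (at x) v) S)"

text \<open>Meant for open \<open>S\<close>: derivatives are taken at points of \<open>S\<close> in the ambient space, over the reals.\<close>
definition smooth_on :: "('a::real_normed_vector \<Rightarrow> 'b::real_normed_vector) \<Rightarrow> 'a set \<Rightarrow> bool" where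
  "smooth_on f S \<longleftrightarrow> (\<forall>m. Ck_on m f S)"

text \<open>\<open>J $ k $ i\<close> is the holomorphic partial derivative of the \<open>k\<close>-th component in the \<open>i\<close>-th variable.\<close>
definition has_complex_jacobian ::
    "('n::finite cvec \<Rightarrow> 'n cvec) \<Rightarrow> 'n cmat \<Rightarrow> 'n cvec \<Rightarrow> bool" where
  "has_complex_jacobian F J z \<longleftrightarrow> (F has_derivative (\<lambda>v. J *v v)) (at z)"

section \<open>Hermitian manifolds\<close>

type_synonym ('a, 'n) cchart = "'a set \<times> ('a \<Rightarrow> 'n cvec)"

text \<open>Charts are pairs of a domain and a coordinate map; the values of the map outside the domain
  are irrelevant.\<close>
definition chart_image :: "('a, 'n::finite) cchart \<Rightarrow> ('n cvec) set" where
  "chart_image c = snd c ` fst c"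

definition is_cchart :: "'a topology \<Rightarrow> ('a, 'n::finite) cchart \<Rightarrow> bool" where
  "is_cchart X c \<longleftrightarrow> openin X (fst c) \<and> open (chart_image c) \<and>
     homeomorphic_map (subtopology X (fst c)) (top_of_set (chart_image c)) (snd c)"

definition transition :: "('a, 'n::finite) cchart \<Rightarrow> ('a, 'n) cchart \<Rightarrow> 'n cvec \<Rightarrow> 'n cvec" where
  "transition c d = snd d \<circ> inv_into (fst c) (snd c)"

definition complex_manifold :: "'a topology \<Rightarrow> ('a, 'n::finite) cchart set \<Rightarrow> bool" where
  "complex_manifold X \<A> \<longleftrightarrow>
     Hausdorff_space X \<and> second_countable X \<and>
     (\<forall>c\<in>\<A>. is_cchart X c) \<and> (\<Union>c\<in>\<A>. fst c) = topspace X \<and>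
     (\<forall>c\<in>\<A>. \<forall>d\<in>\<A>. \<forall>p \<in> fst c \<inter> fst d. \<exists>J. has_complex_jacobian (transition c d) J (snd c p))"

text \<open>A Hermitian metric is given by its coefficient matrices in the charts:
  \<open>h c z $ i $ j\<close> is the coefficient $h_{i\bar j}$ in the chart \<open>c\<close>, at the point with coordinates \<open>z\<close>.
  The last clause is the tensorial transformation law
  $h^{c}_{i\bar j} = \sum_{k,l} \frac{\partial w^k}{\partial z^i}
     \overline{\frac{\partial w^l}{\partial z^j}}\, h^{d}_{k\bar l}$.\<close>
definition hermitian_metric ::
    "('a, 'n::finite) cchart set \<Rightarrow> (('a, 'n) cchart \<Rightarrow> 'n cvec \<Rightarrow> 'n cmat) \<Rightarrow> bool" where
  "hermitian_metric \<A> h \<longleftrightarrow>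
     (\<forall>c\<in>\<A>. smooth_on (h c) (chart_image c)) \<and>
     (\<forall>c\<in>\<A>. \<forall>z\<in>chart_image c.
        (\<forall>i j. cnj (h c z $ i $ j) = h c z $ j $ i) \<and>
        (\<forall>v. v \<noteq> 0 \<longrightarrow> 0 < Re (\<Sum>i\<in>UNIV. \<Sum>j\<in>UNIV. h c z $ i $ j * v $ i * cnj (v $ j)))) \<and>
     (\<forall>c\<in>\<A>. \<forall>d\<in>\<A>. \<forall>p \<in> fst c \<inter> fst d. \<forall>J.
        has_complex_jacobian (transition c d) J (snd c p) \<longrightarrow>
        (\<forall>i j. h c (snd c p) $ i $ j =
          (\<Sum>k\<in>UNIV. \<Sum>l\<in>UNIV. J $ k $ i * cnj (J $ l $ j) * h d (snd d p) $ k $ l)))"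

definition hermitian_manifold ::
    "'a topology \<Rightarrow> ('a, 'n::finite) cchart set \<Rightarrow> (('a, 'n) cchart \<Rightarrow> 'n cvec \<Rightarrow> 'n cmat) \<Rightarrow> bool" where
  "hermitian_manifold X \<A> h \<longleftrightarrow> complex_manifold X \<A> \<and> hermitian_metric \<A> h"

section \<open>Wirtinger derivatives and curvature\<close>

definition dpart :: "'n::finite \<Rightarrow> ('n cvec \<Rightarrow> complex) \<Rightarrow> 'n cvec \<Rightarrow> complex" where
  "dpart i f z = (frechet_derivative f (at z) (axis i 1)
                    - \<i> * frechet_derivative f (at z) (axis i \<i>)) / 2"

definition dbarpart :: "'n::finite \<Rightarrow> ('n cvec \<Rightarrow> complex) \<Rightarrow> 'n cvec \<Rightarrow> complex" where
  "dbarpart i f z = (frechet_derivative f (at z) (axis i 1)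
                    + \<i> * frechet_derivative f (at z) (axis i \<i>)) / 2"

text \<open>In this section and the following ones, \<open>H\<close> is a Hermitian matrix at a point and
  \<open>h\<close> is a matrix-valued function of the coordinates. \<open>hup H i j\<close> is $h^{i\bar j}$, the transposed inverse,
  so that $\sum_j h^{i\bar j} h_{k\bar j} = \delta_{ik}$.\<close>
definition hup :: "'n cmat \<Rightarrow> 'n \<Rightarrow> 'n::finite \<Rightarrow> complex" where
  "hup H i j = transpose (matrix_inv H) $ i $ j"

text \<open>\<open>christoffel h i j k\<close> is $\Gamma_{ij}^k$, and \<open>curv h i j k l\<close> is $R_{i\bar jk\bar l}$.\<close>
definition christoffel :: "('n cvec \<Rightarrow> 'n cmat) \<Rightarrow> 'n \<Rightarrow> 'n \<Rightarrow> 'n \<Rightarrow> 'n::finite cvec \<Rightarrow> complex" where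
  "christoffel h i j k z = (\<Sum>l\<in>UNIV. hup (h z) k l * dpart i (\<lambda>w. h w $ j $ l) z)"

definition curv :: "('n cvec \<Rightarrow> 'n cmat) \<Rightarrow> 'n \<Rightarrow> 'n \<Rightarrow> 'n \<Rightarrow> 'n \<Rightarrow> 'n::finite cvec \<Rightarrow> complex" where
  "curv h i j k l z = - (\<Sum>p\<in>UNIV. h z $ p $ l * dbarpart j (christoffel h i k p) z)"

definition scal :: "('n cvec \<Rightarrow> 'n cmat) \<Rightarrow> 'n::finite cvec \<Rightarrow> complex" where
  "scal h z = (\<Sum>i\<in>UNIV. \<Sum>j\<in>UNIV. \<Sum>k\<in>UNIV. \<Sum>l\<in>UNIV.
     hup (h z) i j * hup (h z) k l * curv h i j k l z)"

definition scal_hat :: "('n cvec \<Rightarrow> 'n cmat) \<Rightarrow> 'n::finite cvec \<Rightarrow> complex" where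
  "scal_hat h z = (\<Sum>i\<in>UNIV. \<Sum>j\<in>UNIV. \<Sum>k\<in>UNIV. \<Sum>l\<in>UNIV.
     hup (h z) i l * hup (h z) k j * curv h i j k l z)"

section \<open>The exterior algebra on $dz^i$, $d\bar z^i$\<close>

text \<open>\<open>DZ i\<close> and \<open>DZB i\<close> stand for $dz^i$ and $d\bar z^i$. They are ordered with all $dz^i$ before all
  $d\bar z^j$, and otherwise by the index.\<close>
datatype 'n cogen = DZ (cogen_index: 'n) | DZB (cogen_index: 'n)

lemma UNIV_cogen: "(UNIV :: 'n cogen set) = range DZ \<union> range DZB"
proof -
  have "x \<in> range DZ \<union> range DZB" for x :: "'n cogen" by (cases x) auto
  then show ?thesis by blast
qed

instance cogen :: (finite) finite
  by standard (simp add: UNIV_cogen)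

instantiation cogen :: (linorder) linorder
begin

fun less_eq_cogen :: "'a cogen \<Rightarrow> 'a cogen \<Rightarrow> bool" where
  "less_eq_cogen (DZ i) (DZ j) \<longleftrightarrow> i \<le> j"
| "less_eq_cogen (DZ i) (DZB j) \<longleftrightarrow> True"
| "less_eq_cogen (DZB i) (DZ j) \<longleftrightarrow> False"
| "less_eq_cogen (DZB i) (DZB j) \<longleftrightarrow> i \<le> j"

definition less_cogen :: "'a cogen \<Rightarrow> 'a cogen \<Rightarrow> bool" where
  "less_cogen x y \<longleftrightarrow> x \<le> y \<and> \<not> y \<le> x"

instance
proof
  fix x y z :: "'a cogen"
  show "x < y \<longleftrightarrow> x \<le> y \<and> \<not> y \<le> x" by (rule less_cogen_def)
  show "x \<le> x" by (cases x) auto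
  show "x \<le> y \<Longrightarrow> y \<le> z \<Longrightarrow> x \<le> z" by (cases x; cases y; cases z) auto
  show "x \<le> y \<Longrightarrow> y \<le> x \<Longrightarrow> x = y" by (cases x; cases y) auto
  show "x \<le> y \<or> y \<le> x" by (cases x; cases y) auto
qed

end

fun cogen_swap :: "'n cogen \<Rightarrow> 'n cogen" where
  "cogen_swap (DZ i) = DZB i"
| "cogen_swap (DZB i) = DZ i"

text \<open>An element of the complexified exterior algebra at a point: \<open>\<phi> $ S\<close> is the coefficient of the
  wedge product of the elements of \<open>S\<close> in increasing order.\<close>
type_synonym 'n ext = "complex ^ ('n cogen set)"

definition emono :: "'n cogen set \<Rightarrow> 'n::finite ext" where
  "emono S = axis S 1"

definition shuffle_sign :: "'n::{finite,linorder} cogen set \<Rightarrow> 'n cogen set \<Rightarrow> complex" where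
  "shuffle_sign S T = (-1) ^ card {(a, b). a \<in> S \<and> b \<in> T \<and> b < a}"

definition wedge :: "'n::{finite,linorder} ext \<Rightarrow> 'n ext \<Rightarrow> 'n ext"  (infixr "\<and>\<^sub>e" 75) where
  "\<phi> \<and>\<^sub>e \<psi> = (\<chi> S. \<Sum>I\<in>Pow S. shuffle_sign I (S - I) * \<phi> $ I * \<psi> $ (S - I))"

primrec wedge_power :: "'n::{finite,linorder} ext \<Rightarrow> nat \<Rightarrow> 'n ext" where
  "wedge_power \<phi> 0 = emono {}"
| "wedge_power \<phi> (Suc m) = \<phi> \<and>\<^sub>e wedge_power \<phi> m"

text \<open>Complex conjugation. The sign comes from restoring the increasing order:
  $\overline{dz^I \wedge d\bar z^J} = d\bar z^I \wedge dz^J = (-1)^{|I||J|} dz^J \wedge d\bar z^I$.\<close>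
definition ext_cnj :: "'n::finite ext \<Rightarrow> 'n ext" where
  "ext_cnj \<phi> = (\<chi> S. (-1) ^ (card (S \<inter> range DZ) * card (S \<inter> range DZB)) * cnj (\<phi> $ (cogen_swap ` S)))"

text \<open>The inner product on 1-forms: $\langle dz^i, dz^j\rangle = h^{i\bar j}$, forms of type (1,0) and (0,1) are
  orthogonal, and $\langle d\bar z^i, d\bar z^j\rangle = \overline{\langle dz^i, dz^j\rangle}$.\<close>
fun cogen_inner :: "'n cmat \<Rightarrow> 'n cogen \<Rightarrow> 'n::finite cogen \<Rightarrow> complex" where
  "cogen_inner H (DZ i) (DZ j) = hup H i j"
| "cogen_inner H (DZB i) (DZB j) = cnj (hup H i j)"
| "cogen_inner H (DZ i) (DZB j) = 0"
| "cogen_inner H (DZB i) (DZ j) = 0"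

text \<open>The determinant of the Gram matrix of the monomials \<open>S\<close> and \<open>T\<close>; monomials of different degrees
  are orthogonal.\<close>
definition mono_inner :: "'n cmat \<Rightarrow> 'n cogen set \<Rightarrow> 'n::{finite,linorder} cogen set \<Rightarrow> complex" where
  "mono_inner H S T = (if card S = card T then
     (\<Sum>\<pi> | \<pi> permutes {..<card S}. of_int (sign \<pi>) *
        (\<Prod>m<card S. cogen_inner H (sorted_list_of_set S ! m) (sorted_list_of_set T ! \<pi> m)))
     else 0)"

definition ext_inner :: "'n cmat \<Rightarrow> 'n::{finite,linorder} ext \<Rightarrow> 'n ext \<Rightarrow> complex" where
  "ext_inner H \<phi> \<psi> = (\<Sum>S\<in>UNIV. \<Sum>T\<in>UNIV. \<phi> $ S * cnj (\<psi> $ T) * mono_inner H S T)"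

definition ext_norm2 :: "'n cmat \<Rightarrow> 'n::{finite,linorder} ext \<Rightarrow> complex" where
  "ext_norm2 H \<phi> = ext_inner H \<phi> \<phi>"

text \<open>The element $\sqrt{-1} \sum h_{i\bar j}\, dz^i \wedge d\bar z^j$.\<close>
definition fund :: "'n cmat \<Rightarrow> 'n::{finite,linorder} ext" where
  "fund H = (\<Sum>i\<in>UNIV. \<Sum>j\<in>UNIV. (\<i> * H $ i $ j) *s (emono {DZ i} \<and>\<^sub>e emono {DZB j}))"

definition vol :: "'n cmat \<Rightarrow> 'n::{finite,linorder} ext" where
  "vol H = (1 / fact CARD('n)) *s wedge_power (fund H) CARD('n)"

text \<open>The Hodge star is the complex-linear map determined by
  $\varphi \wedge *\psi = \langle\varphi,\bar\psi\rangle\, dv$ for \<open>\<phi>\<close>, \<open>\<psi>\<close> of equal degree.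
  Comparing only the coefficient of the top monomial \<open>UNIV\<close> lets \<open>\<phi>\<close> range over all degrees: for \<open>\<psi>\<close> of
  degree $p$ the conditions with \<open>\<phi>\<close> of another degree say that $*\psi$ has degree $2n-p$.\<close>
definition hodge_star :: "'n cmat \<Rightarrow> 'n::{finite,linorder} ext \<Rightarrow> 'n ext" where
  "hodge_star H \<psi> = (THE \<xi>. \<forall>\<phi>. (\<phi> \<and>\<^sub>e \<xi>) $ UNIV = ext_inner H \<phi> (ext_cnj \<psi>) * vol H $ UNIV)"

section \<open>Differential forms in a chart\<close>

type_synonym 'n cform = "'n cvec \<Rightarrow> 'n ext"

definition del :: "'n::{finite,linorder} cform \<Rightarrow> 'n cform" where
  "del \<phi> z = (\<Sum>i\<in>UNIV. emono {DZ i} \<and>\<^sub>e (\<chi> S. dpart i (\<lambda>w. \<phi> w $ S) z))"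

definition delbar :: "'n::{finite,linorder} cform \<Rightarrow> 'n cform" where
  "delbar \<phi> z = (\<Sum>i\<in>UNIV. emono {DZB i} \<and>\<^sub>e (\<chi> S. dbarpart i (\<lambda>w. \<phi> w $ S) z))"

definition star_form :: "('n cvec \<Rightarrow> 'n cmat) \<Rightarrow> 'n::{finite,linorder} cform \<Rightarrow> 'n cform" where
  "star_form h \<phi> z = hodge_star (h z) (\<phi> z)"

definition del_adj :: "('n cvec \<Rightarrow> 'n cmat) \<Rightarrow> 'n::{finite,linorder} cform \<Rightarrow> 'n cform" where
  "del_adj h \<phi> z = - star_form h (delbar (star_form h \<phi>)) z"

definition fund_form :: "('n cvec \<Rightarrow> 'n cmat) \<Rightarrow> 'n::{finite,linorder} cform" where
  "fund_form h z = fund (h z)"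

text \<open>A global form on the manifold vanishes iff it vanishes in all charts of the atlas.\<close>
definition k_gauduchon ::
    "('a, 'n::{finite,linorder}) cchart set \<Rightarrow> (('a, 'n) cchart \<Rightarrow> 'n cvec \<Rightarrow> 'n cmat) \<Rightarrow> nat \<Rightarrow> bool" where
  "k_gauduchon \<A> h k \<longleftrightarrow>
     (\<forall>c\<in>\<A>. \<forall>z\<in>chart_image c.
        \<i> *s (del (delbar (\<lambda>w. wedge_power (fund_form (h c) w) k)) z
               \<and>\<^sub>e wedge_power (fund_form (h c) z) (CARD('n) - k - 1)) = 0)"

end

theory Submission
  imports Defs "Jordan_Normal_Form.Determinant"
begin

text \<open>
  Write \<open>\<omega>[p] = \<omega>^p / p!\<close>. With respect to the inner product of \<open>H\<close> the adjoint of \<open>dx \<and> _\<close> is an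
  antiderivation \<open>J x\<close>, and \<open>J\<close> of the conjugate generator sends \<open>\<omega>\<close> to \<open>\<plusminus>i dx\<close>. The image of \<open>J\<close> has
  no top-degree part, so applying it to \<open>\<theta> \<and> \<omega>[p+1]\<close> gives a Wick rule that trades
  \<open>dx \<and> \<theta> \<and> \<omega>[p]\<close> for \<open>J \<theta> \<and> \<omega>[p+1]\<close> in top degree. Hence \<open>\<omega>[n-m]\<close> is the Hodge star of
  \<open>\<omega>[m]\<close>, and all the top-degree forms involved become contractions with $h^{i\bar j}$, without
  passing to a unitary frame.

  Let $N_1 = |\partial\omega|^2$, $N_2 = |\partial^*\omega|^2$, and let $Q$ be the trace of
  $\partial_i\partial_{\bar j} h_{k\bar l}$ against
  $h^{i\bar j}h^{k\bar l} - h^{i\bar l}h^{k\bar j}$. Up to a nonzero factor the form whose vanishing is the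
  $k$-Gauduchon condition is $(k-1)(N_1-N_2) - (n-2)Q$ times the volume form, while
  $s - \hat s = N_1 - \bar Q$; as $N_1$ and $N_2$ are real, the two conditions agree.
\<close>

section \<open>Creation and contraction operators\<close>

no_notation vec_index (infixl "$" 100)

text \<open>The inner product is given by Gram determinants of sorted monomials, which is awkward to
  compute with. Laplace expansion along the row of the smallest generator is where these
  determinants are opened; it yields adjointness, and from then on inner products and top-degree
  coefficients are evaluated by moving one generator at a time. Staying in coordinates keeps the
  generators closed, so derivatives fall on coefficients alone; a unitary frame would bring in
  derivatives of the frame.

  The constants have two origins. Up to the factor k, \<partial> and its conjugate applied to
  \<omega>^k give the Hessian term with \<omega>^(k-1) and k-1 times the torsion term with
  \<omega>^(k-2). After multiplication by \<omega>^(n-k-1) the exponents are n-2 and n-3, and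
  passing to divided powers leaves the relative factor n-2. The six complete contractions of
  \<partial>\<omega> wedged with its conjugate split into two that form N_1 and four that form N_2
  with the opposite sign, which is why only the difference N_1 - N_2 enters.\<close>

lemma ext_eq_iff: "(\<phi> :: 'n::finite ext) = \<psi> \<longleftrightarrow> (\<forall>S. \<phi> $ S = \<psi> $ S)"
  by (rule Finite_Cartesian_Product.vec_eq_iff)

text \<open>The sign of moving \<open>dx\<close> past the generators of \<open>S\<close> that precede it.\<close>
definition gen_sign :: "'n::{finite,linorder} cogen \<Rightarrow> 'n cogen set \<Rightarrow> complex" where
  "gen_sign x S = (-1) ^ card {b\<in>S. b < x}"

definition ext_gen :: "'n::{finite,linorder} cogen \<Rightarrow> 'n ext" where
  "ext_gen x = emono {x}"

text \<open>Interior multiplication by the vector dual to \<open>x\<close>: the coefficient at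
  \<open>S\<close> comes from \<open>insert x S\<close>, with the sign for moving \<open>x\<close>
  to the front.\<close>

definition contr :: "'n::{finite,linorder} cogen \<Rightarrow> 'n ext \<Rightarrow> 'n ext" where
  "contr x \<phi> = (\<chi> S. if x \<in> S then 0 else gen_sign x S * \<phi> $ insert x S)"

text \<open>The parity automorphism. It carries the sign of graded Leibniz rules without any
  homogeneity assumption.\<close>

definition grade_inv :: "'n::{finite,linorder} ext \<Rightarrow> 'n ext" where
  "grade_inv \<phi> = (\<chi> S. (-1) ^ card S * \<phi> $ S)"

lemma gen_sign_sq [simp]: "gen_sign x S * gen_sign x S = 1"
  by (simp add: gen_sign_def flip: power_add mult_2)

lemma gen_sign_insert:
  assumes "y \<notin> S"
  shows "gen_sign x (insert y S) = (if y < x then - gen_sign x S else gen_sign x S)"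
proof -
  have "{b \<in> insert y S. b < x} = (if y < x then insert y {b\<in>S. b < x} else {b\<in>S. b < x})"
    by auto
  then show ?thesis using assms by (auto simp: gen_sign_def)
qed

lemma gen_sign_insert_self [simp]: "gen_sign x (insert x S) = gen_sign x S"
proof -
  have "{b \<in> insert x S. b < x} = {b\<in>S. b < x}" by auto
  then show ?thesis by (simp add: gen_sign_def)
qed

lemma gen_sign_remove_self [simp]: "gen_sign x (S - {x}) = gen_sign x S"
proof -
  have "{b \<in> S - {x}. b < x} = {b\<in>S. b < x}" by auto
  then show ?thesis by (simp add: gen_sign_def)
qed

lemma shuffle_sign_single: "shuffle_sign {x} S = gen_sign x S"
proof -
  have "{(a, b). a \<in> {x} \<and> b \<in> S \<and> b < a} = Pair x ` {b\<in>S. b < x}" by auto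
  then show ?thesis by (simp add: shuffle_sign_def gen_sign_def card_image inj_on_def)
qed

lemma shuffle_sign_empty [simp]: "shuffle_sign {} S = 1" "shuffle_sign S {} = 1"
  by (simp_all add: shuffle_sign_def)

text \<open>Inversions are counted pairwise, so they split over disjoint unions. Together with the
  right-hand version this is the cocycle identity behind associativity of the wedge product.\<close>

lemma shuffle_sign_Un_left:
  assumes "I \<inter> J = {}"
  shows "shuffle_sign (I \<union> J) K = shuffle_sign I K * shuffle_sign J K"
proof -
  have "{(a, b). a \<in> I \<union> J \<and> b \<in> K \<and> b < a} =
        {(a, b). a \<in> I \<and> b \<in> K \<and> b < a} \<union> {(a, b). a \<in> J \<and> b \<in> K \<and> b < a}" by auto
  moreover have "{(a, b). a \<in> I \<and> b \<in> K \<and> b < a} \<inter> {(a, b). a \<in> J \<and> b \<in> K \<and> b < a} = {}"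
    using assms by auto
  ultimately show ?thesis by (simp add: shuffle_sign_def card_Un_disjoint power_add)
qed

lemma shuffle_sign_Un_right:
  assumes "J \<inter> K = {}"
  shows "shuffle_sign I (J \<union> K) = shuffle_sign I J * shuffle_sign I K"
proof -
  have "{(a, b). a \<in> I \<and> b \<in> J \<union> K \<and> b < a} =
        {(a, b). a \<in> I \<and> b \<in> J \<and> b < a} \<union> {(a, b). a \<in> I \<and> b \<in> K \<and> b < a}" by auto
  moreover have "{(a, b). a \<in> I \<and> b \<in> J \<and> b < a} \<inter> {(a, b). a \<in> I \<and> b \<in> K \<and> b < a} = {}"
    using assms by auto
  ultimately show ?thesis by (simp add: shuffle_sign_def card_Un_disjoint power_add)
qed

section \<open>Bilinearity, monomials and associativity of the wedge product\<close>

lemma wedge_add_left: "(a + b) \<and>\<^sub>e c = a \<and>\<^sub>e c + b \<and>\<^sub>e c"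
  by (simp add: wedge_def ext_eq_iff algebra_simps sum.distrib)

lemma wedge_add_right: "a \<and>\<^sub>e (b + c) = a \<and>\<^sub>e b + a \<and>\<^sub>e c"
  by (simp add: wedge_def ext_eq_iff algebra_simps sum.distrib)

lemma wedge_scale_left: "(k *s a) \<and>\<^sub>e c = k *s (a \<and>\<^sub>e c)"
  by (simp add: wedge_def ext_eq_iff sum_distrib_left algebra_simps)

lemma wedge_scale_right: "a \<and>\<^sub>e (k *s c) = k *s (a \<and>\<^sub>e c)"
  by (simp add: wedge_def ext_eq_iff sum_distrib_left algebra_simps)

lemma wedge_zero_left [simp]: "0 \<and>\<^sub>e c = 0"
  by (simp add: wedge_def ext_eq_iff)

lemma wedge_zero_right [simp]: "c \<and>\<^sub>e 0 = 0"
  by (simp add: wedge_def ext_eq_iff)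

lemma wedge_minus_left: "(- a) \<and>\<^sub>e c = - (a \<and>\<^sub>e c)"
  by (simp add: wedge_def ext_eq_iff sum_negf)

lemma wedge_minus_right: "a \<and>\<^sub>e (- c) = - (a \<and>\<^sub>e c)"
  by (simp add: wedge_def ext_eq_iff sum_negf)

lemma wedge_diff_left: "(a - b) \<and>\<^sub>e c = a \<and>\<^sub>e c - b \<and>\<^sub>e c"
  by (simp add: wedge_def ext_eq_iff algebra_simps sum_subtractf)

lemma wedge_diff_right: "a \<and>\<^sub>e (b - c) = a \<and>\<^sub>e b - a \<and>\<^sub>e c"
  by (simp add: wedge_def ext_eq_iff algebra_simps sum_subtractf)

lemma wedge_sum_left: "(\<Sum>i\<in>A. f i) \<and>\<^sub>e c = (\<Sum>i\<in>A. f i \<and>\<^sub>e c)"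
  by (induction A rule: infinite_finite_induct) (auto simp: wedge_add_left)

lemma wedge_sum_right: "c \<and>\<^sub>e (\<Sum>i\<in>A. f i) = (\<Sum>i\<in>A. c \<and>\<^sub>e f i)"
  by (induction A rule: infinite_finite_induct) (auto simp: wedge_add_right)

lemma ext_mono_decomp: "\<phi> = (\<Sum>S\<in>UNIV. \<phi> $ S *s emono S)"
  by (simp add: ext_eq_iff emono_def axis_def if_distrib cong: if_cong)

lemma ext_mono_induct:
  assumes m: "\<And>S. P (emono S)" and add: "\<And>a b. P a \<Longrightarrow> P b \<Longrightarrow> P (a + b)"
    and sc: "\<And>c a. P a \<Longrightarrow> P (c *s a)"
  shows "P \<phi>"
proof -
  have z: "P 0" using sc[OF m, of 0 "{}"] by simp
  have "P (\<Sum>S\<in>A. \<phi> $ S *s emono S)" for A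
    by (induction A rule: infinite_finite_induct) (auto intro: m add sc z)
  then show ?thesis using ext_mono_decomp[of \<phi>] by metis
qed

lemma emono_nth: "emono S $ T = (if T = S then 1 else 0)"
  by (auto simp: emono_def axis_def)

lemma emono_wedge:
  "emono I \<and>\<^sub>e emono J = (if I \<inter> J = {} then shuffle_sign I J *s emono (I \<union> J) else 0)"
proof -
  have "(emono I \<and>\<^sub>e emono J) $ S = (if I \<inter> J = {} then shuffle_sign I J *s emono (I \<union> J) else 0) $ S" for S
  proof -
    have "(emono I \<and>\<^sub>e emono J) $ S
        = (\<Sum>K\<in>Pow S. if K = I then (if S - I = J then shuffle_sign I J else 0) else 0)"
      unfolding wedge_def vec_lambda_beta by (rule sum.cong) (auto simp: emono_nth)
    also have "\<dots> = (if I \<subseteq> S \<and> S - I = J then shuffle_sign I J else 0)"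
      by auto
    also have "\<dots> = (if I \<inter> J = {} then shuffle_sign I J *s emono (I \<union> J) else 0) $ S"
      by (auto simp: emono_nth)
    finally show ?thesis .
  qed
  then show ?thesis by (simp add: ext_eq_iff)
qed

lemma wedge_one_left [simp]: "emono {} \<and>\<^sub>e \<phi> = \<phi>"
  by (induction \<phi> rule: ext_mono_induct) (auto simp: emono_wedge wedge_add_right wedge_scale_right)

lemma wedge_one_right [simp]: "\<phi> \<and>\<^sub>e emono {} = \<phi>"
  by (induction \<phi> rule: ext_mono_induct) (auto simp: emono_wedge wedge_add_left wedge_scale_left)

lemma emono_wedge_assoc: "(emono I \<and>\<^sub>e emono J) \<and>\<^sub>e emono K = emono I \<and>\<^sub>e (emono J \<and>\<^sub>e emono K)"
proof (cases "I \<inter> J = {} \<and> J \<inter> K = {} \<and> I \<inter> K = {}")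
  case True
  then have "(I \<union> J) \<inter> K = {}" "I \<inter> (J \<union> K) = {}" by auto
  then show ?thesis using True
    by (simp add: emono_wedge wedge_scale_left wedge_scale_right shuffle_sign_Un_left
        shuffle_sign_Un_right Un_assoc mult_ac)
next
  case False
  then show ?thesis
    by (auto simp: emono_wedge wedge_scale_left wedge_scale_right Int_Un_distrib Int_Un_distrib2)
qed

lemma wedge_assoc: "(a \<and>\<^sub>e b) \<and>\<^sub>e c = a \<and>\<^sub>e (b \<and>\<^sub>e c)"
proof (induction a rule: ext_mono_induct)
  case (1 I)
  show ?case
  proof (induction b rule: ext_mono_induct)
    case (1 J)
    show ?case
      by (induction c rule: ext_mono_induct)
        (auto simp: emono_wedge_assoc wedge_add_right wedge_scale_right)
  qed (auto simp: wedge_add_left wedge_add_right wedge_scale_right wedge_scale_left)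
qed (auto simp: wedge_add_left wedge_scale_left)

lemma ext_gen_wedge_nth:
  "(ext_gen x \<and>\<^sub>e \<phi>) $ S = (if x \<in> S then gen_sign x S * \<phi> $ (S - {x}) else 0)"
proof -
  have "(ext_gen x \<and>\<^sub>e \<phi>) $ S
      = (\<Sum>K\<in>Pow S. if K = {x} then gen_sign x S * \<phi> $ (S - {x}) else 0)"
    unfolding wedge_def vec_lambda_beta
    by (rule sum.cong) (auto simp: ext_gen_def emono_nth shuffle_sign_single)
  also have "\<dots> = (if x \<in> S then gen_sign x S * \<phi> $ (S - {x}) else 0)"
    by auto
  finally show ?thesis .
qed

lemma ext_gen_wedge_emono:
  "ext_gen x \<and>\<^sub>e emono S = (if x \<in> S then 0 else gen_sign x S *s emono (insert x S))"
  by (simp add: ext_gen_def emono_wedge shuffle_sign_single)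

text \<open>Monomials are iterated products of generators, so a linear statement only has to survive
  left multiplication by one generator. This fits the operator identities below, which are
  commutation rules with \<open>ext_gen x\<close>.\<close>

lemma ext_gen_induct [case_names one gen add scale]:
  assumes one: "P (emono {})" and gen: "\<And>x a. P a \<Longrightarrow> P (ext_gen x \<and>\<^sub>e a)"
    and add: "\<And>a b. P a \<Longrightarrow> P b \<Longrightarrow> P (a + b)"
    and sc: "\<And>c a. P a \<Longrightarrow> P (c *s a)"
  shows "P (\<phi> :: 'n::{finite,linorder} ext)"
proof (induction \<phi> rule: ext_mono_induct)
  case (1 S)
  have "finite S" by simp
  then show ?case
  proof (induction S)
    case empty then show ?case by (rule one)
  next
    case (insert x S)
    then have "P (gen_sign x S *s (ext_gen x \<and>\<^sub>e emono S))" by (intro sc gen)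
    then show ?case using insert.hyps by (simp add: ext_gen_wedge_emono)
  qed
qed (use add sc in auto)

lemma wedge_gen_gen_anti: "ext_gen x \<and>\<^sub>e ext_gen y \<and>\<^sub>e \<phi> = - (ext_gen y \<and>\<^sub>e ext_gen x \<and>\<^sub>e \<phi>)"
proof (cases "x = y")
  case True
  then show ?thesis by (simp add: ext_eq_iff ext_gen_wedge_nth)
next
  case False
  have "(ext_gen x \<and>\<^sub>e ext_gen y \<and>\<^sub>e \<phi>) $ S = (- (ext_gen y \<and>\<^sub>e ext_gen x \<and>\<^sub>e \<phi>)) $ S" for S
  proof (cases "x \<in> S \<and> y \<in> S")
    case True
    \<comment> \<open>Over \<open>R\<close> the two orders of multiplication differ only in whether
      \<open>x\<close> and \<open>y\<close> count each other as predecessors, and exactly one of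
      them does.\<close>
    define R where "R = S - {x} - {y}"
    have S: "S = insert x (insert y R)" "x \<notin> R" "y \<notin> R" "insert x (insert y R) - {x} = insert y R"
      "insert x (insert y R) - {y} = insert x R" "insert y R - {y} = R" "insert x R - {x} = R"
      using True False by (auto simp: R_def)
    show ?thesis unfolding S(1) ext_gen_wedge_nth vector_uminus_component S(4,5,6,7)
      using False S(2,3) by (auto simp: gen_sign_insert S(6,7) ext_gen_wedge_nth)
  qed (auto simp: ext_gen_wedge_nth)
  then show ?thesis by (simp add: ext_eq_iff)
qed

lemma wedge_gen_gen_same [simp]: "ext_gen x \<and>\<^sub>e ext_gen x \<and>\<^sub>e \<phi> = 0"
  by (simp add: ext_eq_iff ext_gen_wedge_nth)

section \<open>Contractions and the parity automorphism\<close>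

lemma contr_add: "contr x (a + b) = contr x a + contr x b"
  by (simp add: contr_def ext_eq_iff algebra_simps)

lemma contr_scale: "contr x (c *s a) = c *s contr x a"
  by (simp add: contr_def ext_eq_iff)

lemma contr_one [simp]: "contr x (emono {}) = 0"
  by (simp add: contr_def ext_eq_iff emono_nth)

text \<open>The canonical anticommutation relation between annihilation and creation operators; the
  Leibniz rule \<open>contr_wedge\<close> follows from it by induction over generators.\<close>

lemma contr_gen_wedge:
  "contr x (ext_gen y \<and>\<^sub>e \<phi>) = (if x = y then \<phi> else 0) - ext_gen y \<and>\<^sub>e contr x \<phi>"
proof (cases "x = y")
  case True
  have "contr x (ext_gen x \<and>\<^sub>e \<phi>) $ S = (\<phi> - ext_gen x \<and>\<^sub>e contr x \<phi>) $ S" for S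
    by (cases "x \<in> S")
      (auto simp: contr_def ext_gen_wedge_nth insert_absorb simp flip: mult.assoc)
  then show ?thesis using True by (simp add: ext_eq_iff)
next
  case False
  have "contr x (ext_gen y \<and>\<^sub>e \<phi>) $ S = (- (ext_gen y \<and>\<^sub>e contr x \<phi>)) $ S" for S
  proof (cases "x \<notin> S \<and> y \<in> S")
    case True
    define R where "R = S - {y}"
    have S: "S = insert y R" "x \<notin> R" "y \<notin> R" "insert x (insert y R) - {y} = insert x R"
      "insert y R - {y} = R"
      using True False by (auto simp: R_def)
    show ?thesis unfolding S(1) contr_def using False S(2,3)
      by (auto simp: gen_sign_insert S(4,5) ext_gen_wedge_nth)
  qed (use False in \<open>auto simp: ext_gen_wedge_nth contr_def\<close>)
  then show ?thesis using False by (simp add: ext_eq_iff)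
qed

lemma grade_inv_add: "grade_inv (a + b) = grade_inv a + grade_inv b"
  by (simp add: grade_inv_def ext_eq_iff algebra_simps)

lemma grade_inv_scale: "grade_inv (c *s a) = c *s grade_inv a"
  by (simp add: grade_inv_def ext_eq_iff)

lemma grade_inv_one [simp]: "grade_inv (emono {}) = emono {}"
  by (simp add: grade_inv_def ext_eq_iff emono_nth)

lemma grade_inv_gen_wedge: "grade_inv (ext_gen x \<and>\<^sub>e a) = - (ext_gen x \<and>\<^sub>e grade_inv a)"
proof -
  have "grade_inv (ext_gen x \<and>\<^sub>e a) $ S = (- (ext_gen x \<and>\<^sub>e grade_inv a)) $ S" for S
  proof (cases "x \<in> S")
    case True
    then have "card S = Suc (card (S - {x}))" by (metis card_Suc_Diff1 finite)
    then have "(-1 :: complex) ^ card S = - ((-1) ^ card (S - {x}))"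
      by (metis power_Suc mult_minus1)
    then show ?thesis using True by (simp add: grade_inv_def ext_gen_wedge_nth del: card_Diff_insert)
  qed (simp add: grade_inv_def ext_gen_wedge_nth)
  then show ?thesis by (simp add: ext_eq_iff)
qed

lemma grade_inv_wedge: "grade_inv (a \<and>\<^sub>e b) = grade_inv a \<and>\<^sub>e grade_inv b"
  by (induction a rule: ext_gen_induct)
    (auto simp: grade_inv_gen_wedge wedge_assoc wedge_add_left wedge_scale_left wedge_minus_left
      grade_inv_add grade_inv_scale)

lemma gen_wedge_commute: "ext_gen x \<and>\<^sub>e a = grade_inv a \<and>\<^sub>e ext_gen x"
proof (induction a rule: ext_gen_induct)
  case (gen y a)
  have "ext_gen x \<and>\<^sub>e ext_gen y \<and>\<^sub>e a = - (ext_gen y \<and>\<^sub>e ext_gen x \<and>\<^sub>e a)" by (rule wedge_gen_gen_anti)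
  then show ?case by (simp add: gen grade_inv_gen_wedge wedge_minus_left wedge_assoc)
qed (auto simp: wedge_add_left wedge_add_right wedge_scale_left wedge_scale_right
      grade_inv_add grade_inv_scale)

lemma contr_wedge: "contr x (a \<and>\<^sub>e b) = contr x a \<and>\<^sub>e b + grade_inv a \<and>\<^sub>e contr x b"
proof (induction a rule: ext_gen_induct)
  case (gen y a)
  then show ?case
    by (auto simp: wedge_assoc contr_gen_wedge grade_inv_gen_wedge wedge_minus_left wedge_add_left
        wedge_add_right wedge_diff_left wedge_diff_right)
qed (auto simp: wedge_add_left wedge_scale_left contr_add contr_scale grade_inv_add grade_inv_scale
      vec.scale_right_distrib)

text \<open>Contraction lowers the degree. This plays the part of integration by parts: a total
  contraction has no top coefficient.\<close>

lemma contr_top [simp]: "contr x \<phi> $ UNIV = 0"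
  by (simp add: contr_def)

section \<open>The adjoint of a creation operator\<close>

text \<open>Gives access to cofactor expansion for the permutation sum.\<close>

lemma mono_inner_det:
  assumes "card T = card S"
  shows "mono_inner H S T = Determinant.det (Matrix.mat (card S) (card S)
     (\<lambda>(i, j). cogen_inner H (sorted_list_of_set S ! i) (sorted_list_of_set T ! j)))"
proof -
  have "(\<Prod>m<card S. cogen_inner H (sorted_list_of_set S ! m) (sorted_list_of_set T ! \<pi> m)) =
     (\<Prod>m = 0..<card S. (Matrix.mat (card S) (card S)
     (\<lambda>(i, j). cogen_inner H (sorted_list_of_set S ! i) (sorted_list_of_set T ! j))) $$ (m, \<pi> m))"
    if "\<pi> permutes {..<card S}" for \<pi>
    using permutes_in_image[OF that] by (auto simp: atLeast0LessThan intro!: prod.cong)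
  then show ?thesis using assms
    by (subst det_def'[of _ "card S"])
      (auto simp: mono_inner_def atLeast0LessThan intro!: sum.cong)
qed

lemma remove1_nth: "distinct xs \<Longrightarrow> j < length xs \<Longrightarrow> remove1 (xs ! j) xs = take j xs @ drop (Suc j) xs"
  by (subst (2) id_take_nth_drop[of j xs])
     (auto simp: remove1_append distinct_conv_nth in_set_conv_nth)

text \<open>Since \<open>x\<close> precedes all of \<open>S\<close>, it labels the first row of the
  Gram matrix, along which the determinant is expanded; deleting column \<open>j\<close> deletes one
  generator of \<open>T\<close>.\<close>

lemma mono_inner_laplace:
  fixes S T :: "'n::{finite,linorder} cogen set"
  assumes x: "\<And>b. b \<in> S \<Longrightarrow> x < b"
  shows "mono_inner H (insert x S) T
    = (\<Sum>y\<in>T. gen_sign y T * cogen_inner H x y * mono_inner H S (T - {y}))"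
proof (cases "card T = Suc (card S)")
  case False
  have "x \<notin> S" using x by auto
  moreover have "mono_inner H S (T - {y}) = 0" if "y \<in> T" for y
  proof -
    \<comment> \<open>Positivity keeps \<open>card T - 1\<close> from truncating, so the degrees
      still disagree after removing \<open>y\<close>.\<close>
    have "card T > 0" using that by (auto simp: card_gt_0_iff)
    then show ?thesis using that False by (auto simp: mono_inner_def card_Diff_singleton)
  qed
  ultimately show ?thesis using False by (simp add: mono_inner_def)
next
  case True
  define m where "m = card S"
  define ys where "ys = sorted_list_of_set T"
  define xs where "xs = sorted_list_of_set S"
  define M where "M = Matrix.mat (Suc m) (Suc m) (\<lambda>(i, j). cogen_inner H ((x # xs) ! i) (ys ! j))"
  have len: "length ys = Suc m" "length xs = m" and dist: "distinct ys" and st: "set ys = T"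
    using True by (auto simp: ys_def xs_def m_def)
  have sx: "x \<notin> S" using x by auto
  have srt: "sorted_list_of_set (insert x S) = x # xs"
    unfolding xs_def
    by (metis Diff_empty Diff_insert0 finite insort_is_Cons less_imp_le set_sorted_list_of_set
        sorted_list_of_set_insert_remove sx x)
  have "mono_inner H (insert x S) T = Determinant.det M"
    using sx True by (simp add: mono_inner_det srt M_def m_def ys_def)
  also have "\<dots> = (\<Sum>j<Suc m. M $$ (0, j) * cofactor M 0 j)"
    by (rule laplace_expansion_row) (auto simp: M_def)
  also have "\<dots> = (\<Sum>j<Suc m. gen_sign (ys ! j) T * cogen_inner H x (ys ! j) * mono_inner H S (T - {ys ! j}))"
  proof (rule sum.cong[OF refl])
    fix j assume j: "j \<in> {..<Suc m}"
    have yT: "ys ! j \<in> T" using j len st by (metis lessThan_iff nth_mem)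
    \<comment> \<open>Exactly \<open>j\<close> entries of the sorted list precede
      \<open>ys ! j\<close>, so the cofactor sign of column \<open>j\<close> is its
      \<open>gen_sign\<close>.\<close>
    have "{b \<in> T. b < ys ! j} = set (take j ys)"
    proof -
      have "sorted_wrt (<) ys" unfolding ys_def by (rule strict_sorted_list_of_set)
      then have "\<And>i. i < Suc m \<Longrightarrow> ys ! i < ys ! j \<longleftrightarrow> i < j"
        using j len by (metis lessThan_iff linorder_neqE_nat order_less_asym' order_less_irrefl sorted_wrt_nth_less)
      moreover have "set (take j ys) = (!) ys ` {0..<j}"
        using j len by (intro nth_image[symmetric]) auto
      moreover have "set ys = (!) ys ` {0..<Suc m}"
        using nth_image[of "length ys" ys] len by simp
      ultimately show ?thesis using j unfolding st[symmetric] by auto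
    qed
    then have "card {b \<in> T. b < ys ! j} = j"
      using dist j len by (simp add: distinct_card)
    then have sg: "gen_sign (ys ! j) T = (-1) ^ j" by (simp add: gen_sign_def)
    have srt2: "sorted_list_of_set (T - {ys ! j}) = take j ys @ drop (Suc j) ys"
      using remove1_nth[OF dist] j len by (simp add: sorted_list_of_set_remove flip: ys_def)
    have nth: "(take j ys @ drop (Suc j) ys) ! i = ys ! (if i < j then i else Suc i)" if "i < m" for i
      using that j len by (auto simp: nth_append)
    have "mat_delete M 0 j = Matrix.mat m m
      (\<lambda>(i, j'). cogen_inner H (sorted_list_of_set S ! i) (sorted_list_of_set (T - {ys ! j}) ! j'))"
      unfolding mat_delete_def M_def srt2 by (rule eq_matI) (auto simp: nth xs_def)
    then have "Determinant.det (mat_delete M 0 j) = mono_inner H S (T - {ys ! j})"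
      using yT True by (subst mono_inner_det) (auto simp: m_def)
    then show "M $$ (0, j) * cofactor M 0 j
      = gen_sign (ys ! j) T * cogen_inner H x (ys ! j) * mono_inner H S (T - {ys ! j})"
      using j by (simp add: cofactor_def sg M_def)
  qed
  also have "\<dots> = (\<Sum>y\<in>T. gen_sign y T * cogen_inner H x y * mono_inner H S (T - {y}))"
    by (rule sum.reindex_bij_betw[where h = "\<lambda>j. ys ! j"])
       (use len dist st bij_betw_nth in \<open>auto intro!: bij_betw_nth\<close>)
  finally show ?thesis .
qed

text \<open>The conjugate on the coefficients is forced by antilinearity of \<open>ext_inner\<close>
  in its second argument, where this operator arises as the adjoint of a creation operator.\<close>

definition dual_contr :: "'n cmat \<Rightarrow> 'n::{finite,linorder} cogen \<Rightarrow> 'n ext \<Rightarrow> 'n ext" where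
  "dual_contr H x \<phi> = (\<Sum>y\<in>UNIV. cnj (cogen_inner H x y) *s contr y \<phi>)"

lemma ext_inner_add_left: "ext_inner H (a + b) c = ext_inner H a c + ext_inner H b c"
  by (simp add: ext_inner_def algebra_simps sum.distrib)

lemma ext_inner_add_right: "ext_inner H a (b + c) = ext_inner H a b + ext_inner H a c"
  by (simp add: ext_inner_def algebra_simps sum.distrib)

lemma ext_inner_scale_left: "ext_inner H (k *s a) c = k * ext_inner H a c"
  by (simp add: ext_inner_def algebra_simps sum_distrib_left)

lemma ext_inner_scale_right: "ext_inner H a (k *s c) = cnj k * ext_inner H a c"
  by (simp add: ext_inner_def algebra_simps sum_distrib_left)

lemma ext_inner_zero_left [simp]: "ext_inner H 0 c = 0"
  by (simp add: ext_inner_def)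

lemma ext_inner_zero_right [simp]: "ext_inner H c 0 = 0"
  by (simp add: ext_inner_def)

lemma ext_inner_minus_left: "ext_inner H (- a) c = - ext_inner H a c"
  by (simp add: ext_inner_def sum_negf)

lemma ext_inner_minus_right: "ext_inner H a (- c) = - ext_inner H a c"
  by (simp add: ext_inner_def sum_negf)

lemma ext_inner_diff_left: "ext_inner H (a - b) c = ext_inner H a c - ext_inner H b c"
  by (simp add: ext_inner_def algebra_simps sum_subtractf)

lemma ext_inner_diff_right: "ext_inner H a (b - c) = ext_inner H a b - ext_inner H a c"
  by (simp add: ext_inner_def algebra_simps sum_subtractf)

lemma ext_inner_sum_left: "ext_inner H (\<Sum>i\<in>A. f i) c = (\<Sum>i\<in>A. ext_inner H (f i) c)"
  by (induction A rule: infinite_finite_induct) (auto simp: ext_inner_add_left)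

lemma ext_inner_sum_right: "ext_inner H c (\<Sum>i\<in>A. f i) = (\<Sum>i\<in>A. ext_inner H c (f i))"
  by (induction A rule: infinite_finite_induct) (auto simp: ext_inner_add_right)

lemma ext_inner_emono: "ext_inner H (emono S) (emono T) = mono_inner H S T"
proof -
  have "(\<Sum>B\<in>UNIV. emono S $ A * cnj (emono T $ B) * mono_inner H A B)
      = (if A = S then mono_inner H A T else 0)" for A
  proof -
    have "(\<Sum>B\<in>UNIV. emono S $ A * cnj (emono T $ B) * mono_inner H A B)
      = (\<Sum>B\<in>UNIV. if B = T then emono S $ A * mono_inner H A T else 0)"
      by (rule sum.cong) (auto simp: emono_nth)
    then show ?thesis by (simp add: emono_nth)
  qed
  then show ?thesis by (simp add: ext_inner_def)
qed

lemma contr_emono: "contr y (emono T) = (if y \<in> T then gen_sign y T *s emono (T - {y}) else 0)"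
proof -
  have "contr y (emono T) $ S = (if y \<in> T then gen_sign y T *s emono (T - {y}) else 0) $ S" for S
    by (auto simp: contr_def emono_nth)
  then show ?thesis by (simp add: ext_eq_iff)
qed

lemma dual_contr_add: "dual_contr H x (a + b) = dual_contr H x a + dual_contr H x b"
  by (simp add: dual_contr_def contr_add sum.distrib vec.scale_right_distrib)

lemma dual_contr_scale: "dual_contr H x (c *s a) = c *s dual_contr H x a"
  by (simp add: dual_contr_def contr_scale ext_eq_iff sum_distrib_left mult_ac)

lemma dual_contr_zero [simp]: "dual_contr H x 0 = 0"
  using dual_contr_scale[of H x 0 0] by simp

lemma dual_contr_sum: "dual_contr H x (\<Sum>i\<in>A. f i) = (\<Sum>i\<in>A. dual_contr H x (f i))"
  by (induction A rule: infinite_finite_induct) (auto simp: dual_contr_add)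

lemma dual_contr_minus: "dual_contr H x (- a) = - dual_contr H x a"
  using dual_contr_scale[of H x "-1" a] by (simp add: ext_eq_iff)

lemma dual_contr_diff: "dual_contr H x (a - b) = dual_contr H x a - dual_contr H x b"
  using dual_contr_add[of H x a "- b"] by (simp add: dual_contr_minus)

lemma dual_contr_one [simp]: "dual_contr H x (emono {}) = 0"
  by (simp add: dual_contr_def)

lemma dual_contr_top [simp]: "dual_contr H x \<phi> $ UNIV = 0"
  by (simp add: dual_contr_def)

lemma dual_contr_gen_wedge:
  "dual_contr H x (ext_gen y \<and>\<^sub>e \<phi>) = cnj (cogen_inner H x y) *s \<phi> - ext_gen y \<and>\<^sub>e dual_contr H x \<phi>"
proof -
  have "dual_contr H x (ext_gen y \<and>\<^sub>e \<phi>)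
    = (\<Sum>z\<in>UNIV. (if z = y then cnj (cogen_inner H x z) *s \<phi> else 0)
         - cnj (cogen_inner H x z) *s (ext_gen y \<and>\<^sub>e contr z \<phi>))"
    unfolding dual_contr_def contr_gen_wedge
    by (intro sum.cong) (auto simp: vec.scale_right_diff_distrib)
  then show ?thesis
    by (simp add: sum_subtractf dual_contr_def wedge_sum_right wedge_scale_right)
qed

lemma dual_contr_wedge:
  "dual_contr H x (a \<and>\<^sub>e b) = dual_contr H x a \<and>\<^sub>e b + grade_inv a \<and>\<^sub>e dual_contr H x b"
  by (simp add: dual_contr_def contr_wedge wedge_sum_left wedge_sum_right wedge_scale_left
      wedge_scale_right sum.distrib vec.scale_right_distrib)

text \<open>Moving both contractions past a generator produces two scalar terms of opposite sign,
  antisymmetric in \<open>x\<close> and \<open>y\<close>; the rest is the induction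
  hypothesis.\<close>

lemma dual_contr_anti: "dual_contr H x (dual_contr H y \<phi>) = - dual_contr H y (dual_contr H x \<phi>)"
proof (induction \<phi> rule: ext_gen_induct)
  case (gen z a)
  then show ?case
    by (simp add: dual_contr_gen_wedge dual_contr_diff dual_contr_scale wedge_minus_right algebra_simps)
qed (auto simp: dual_contr_add dual_contr_scale)

lemma dual_contr_same [simp]: "dual_contr H x (dual_contr H x \<phi>) = 0"
  using dual_contr_anti[of H x x \<phi>] by (simp add: ext_eq_iff eq_neg_iff_add_eq_0 flip: mult_2)

lemma gen_sign_min:
  assumes "\<And>b. b \<in> S \<Longrightarrow> x < b"
  shows "gen_sign x S = 1"
proof -
  have *: "{b \<in> S. b < x} = {}" using assms by (auto dest: order_less_asym)
  show ?thesis unfolding gen_sign_def * by simp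
qed

lemma ext_inner_gen_wedge_min:
  assumes "\<And>b. b \<in> S \<Longrightarrow> x < b"
  shows "ext_inner H (ext_gen x \<and>\<^sub>e emono S) \<psi> = ext_inner H (emono S) (dual_contr H x \<psi>)"
proof (induction \<psi> rule: ext_mono_induct)
  case (1 T)
  have "x \<notin> S" using assms by auto
  moreover have "gen_sign x S = 1" using assms by (rule gen_sign_min)
  ultimately have "ext_inner H (ext_gen x \<and>\<^sub>e emono S) (emono T) = mono_inner H (insert x S) T"
    by (simp add: ext_gen_wedge_emono ext_inner_emono)
  also have "\<dots> = (\<Sum>y\<in>T. gen_sign y T * cogen_inner H x y * mono_inner H S (T - {y}))"
    using assms by (rule mono_inner_laplace)
  also have "\<dots> = (\<Sum>y\<in>UNIV. if y \<in> T then gen_sign y T * cogen_inner H x y * mono_inner H S (T - {y}) else 0)"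
    by (simp add: sum.If_cases)
  also have "\<dots> = ext_inner H (emono S) (dual_contr H x (emono T))"
    unfolding dual_contr_def ext_inner_sum_right
    by (intro sum.cong) (auto simp: contr_emono ext_inner_scale_right ext_inner_emono gen_sign_def)
  finally show ?case .
qed (auto simp: ext_inner_add_right dual_contr_add ext_inner_scale_right dual_contr_scale)

text \<open>\<open>S\<close> is built by adding ever smaller generators. If \<open>x\<close> is not
  the smallest, it is exchanged with the smallest one; the sign of that exchange is matched by
  anticommuting the two contractions.\<close>

lemma ext_inner_gen_wedge_emono:
  "ext_inner H (ext_gen x \<and>\<^sub>e emono S) \<psi> = ext_inner H (emono S) (dual_contr H x \<psi>)"
proof -
  have "finite S" by simp
  then show ?thesis
  proof (induction S arbitrary: x \<psi> rule: finite_linorder_min_induct)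
    case empty
    then show ?case by (intro ext_inner_gen_wedge_min) auto
  next
    case (insert y S)
    have "y \<notin> S" using insert.hyps by auto
    moreover have "gen_sign y S = 1" using insert.hyps by (simp add: gen_sign_min)
    ultimately have ins: "emono (insert y S) = ext_gen y \<and>\<^sub>e emono S"
      by (simp add: ext_gen_wedge_emono)
    consider "x < y" | "x = y" | "y < x" by fastforce
    then show ?case
    proof cases
      case 1
      then show ?thesis using insert.hyps by (intro ext_inner_gen_wedge_min) auto
    next
      case 2
      \<comment> \<open>Both sides vanish: a repeated generator on the left, a repeated contraction
        on the right.\<close>
      show ?thesis using insert.hyps by (simp add: ins 2 ext_inner_gen_wedge_min)
    next
      case 3
      \<comment> \<open>Here \<open>y\<close> lies below \<open>x\<close> and all of
        \<open>S\<close>, so the minimal case applies to it even with \<open>x\<close> in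
        between.\<close>
      have *: "ext_inner H (ext_gen y \<and>\<^sub>e ext_gen x \<and>\<^sub>e emono S) \<psi>
          = ext_inner H (ext_gen x \<and>\<^sub>e emono S) (dual_contr H y \<psi>)"
        using ext_inner_gen_wedge_min[of "insert x S" y H \<psi>] 3 insert.hyps
        by (cases "x \<in> S") (auto simp add: ext_gen_wedge_emono[of x] wedge_scale_right
            ext_inner_scale_left)
      have "ext_inner H (ext_gen x \<and>\<^sub>e emono (insert y S)) \<psi>
          = - ext_inner H (ext_gen y \<and>\<^sub>e ext_gen x \<and>\<^sub>e emono S) \<psi>"
        unfolding ins by (subst wedge_gen_gen_anti) (simp add: ext_inner_minus_left)
      also have "\<dots> = - ext_inner H (emono S) (dual_contr H x (dual_contr H y \<psi>))"
        unfolding * insert.IH ..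
      also have "\<dots> = ext_inner H (emono S) (dual_contr H y (dual_contr H x \<psi>))"
        by (subst dual_contr_anti) (simp add: ext_inner_minus_right)
      also have "\<dots> = ext_inner H (emono (insert y S)) (dual_contr H x \<psi>)"
        unfolding ins using insert.hyps by (simp add: ext_inner_gen_wedge_min)
      finally show ?thesis .
    qed
  qed
qed

lemma ext_inner_gen_wedge_left:
  "ext_inner H (ext_gen x \<and>\<^sub>e \<phi>) \<psi> = ext_inner H \<phi> (dual_contr H x \<psi>)"
  by (induction \<phi> rule: ext_mono_induct)
    (auto simp: ext_inner_gen_wedge_emono wedge_add_right wedge_scale_right ext_inner_add_left
      ext_inner_scale_left)

lemma ext_inner_one_left [simp]: "ext_inner H (emono {}) \<psi> = cnj (\<psi> $ {})"
proof (induction \<psi> rule: ext_mono_induct)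
  case (1 S)
  have "{\<pi>. \<pi> permutes ({} :: nat set)} = {id}" by auto
  then show ?case by (auto simp: ext_inner_emono mono_inner_def emono_nth)
qed (auto simp: ext_inner_add_right ext_inner_scale_right)

section \<open>Powers of the fundamental form and the Hodge star\<close>

definition ext_hom :: "nat \<Rightarrow> 'n::{finite,linorder} ext \<Rightarrow> bool" where
  "ext_hom d \<phi> \<longleftrightarrow> (\<forall>S. \<phi> $ S \<noteq> 0 \<longrightarrow> card S = d)"

lemma ext_hom_add: "ext_hom d a \<Longrightarrow> ext_hom d b \<Longrightarrow> ext_hom d (a + b)"
  unfolding ext_hom_def by (metis add.right_neutral vector_add_component)

lemma ext_hom_scale: "ext_hom d a \<Longrightarrow> ext_hom d (c *s a)"
  by (auto simp: ext_hom_def)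

lemma ext_hom_zero [simp]: "ext_hom d 0"
  by (auto simp: ext_hom_def)

lemma ext_hom_sum: "(\<And>i. i \<in> A \<Longrightarrow> ext_hom d (f i)) \<Longrightarrow> ext_hom d (\<Sum>i\<in>A. f i)"
  by (induction A rule: infinite_finite_induct) (auto intro: ext_hom_add)

lemma ext_hom_one: "ext_hom 0 (emono {})"
  by (auto simp: ext_hom_def emono_nth split: if_splits)

lemma ext_hom_gen: "ext_hom 1 (ext_gen x)"
  by (auto simp: ext_hom_def ext_gen_def emono_nth split: if_splits)

lemma ext_hom_wedge:
  assumes "ext_hom d a" "ext_hom e b"
  shows "ext_hom (d + e) (a \<and>\<^sub>e b)"
  unfolding ext_hom_def
proof (intro allI impI)
  fix S assume "(a \<and>\<^sub>e b) $ S \<noteq> 0"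
  then obtain I where I: "I \<subseteq> S" "a $ I \<noteq> 0" "b $ (S - I) \<noteq> 0"
    by (auto simp: wedge_def elim: sum.not_neutral_contains_not_neutral)
  then have "card I = d" "card (S - I) = e" using assms by (auto simp: ext_hom_def)
  then show "card S = d + e" using I(1) by (metis card_Diff_subset card_mono finite le_add_diff_inverse)
qed

lemma card_UNIV_cogen: "card (UNIV :: 'n::finite cogen set) = 2 * CARD('n)"
proof -
  have "card (range (DZ :: 'n \<Rightarrow> _) \<union> range DZB) = card (range (DZ :: 'n \<Rightarrow> _)) + card (range (DZB :: 'n \<Rightarrow> _))"
    by (rule card_Un_disjoint) auto
  moreover have "card (range (DZ :: 'n \<Rightarrow> _)) = CARD('n)" "card (range (DZB :: 'n \<Rightarrow> _)) = CARD('n)"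
    by (auto intro!: card_image inj_onI)
  ultimately show ?thesis by (simp add: UNIV_cogen)
qed

lemma ext_hom_top_eq_0:
  "ext_hom d (\<phi> :: 'n::{finite,linorder} ext) \<Longrightarrow> d \<noteq> 2 * CARD('n) \<Longrightarrow> \<phi> $ UNIV = 0"
  by (auto simp: ext_hom_def card_UNIV_cogen)

lemma ext_hom_eq_0:
  assumes "ext_hom d (\<phi> :: 'n::{finite,linorder} ext)" "d > 2 * CARD('n)"
  shows "\<phi> = 0"
proof -
  have "card S \<le> 2 * CARD('n)" for S :: "'n cogen set"
    using card_mono[of UNIV S] by (simp add: card_UNIV_cogen)
  then show ?thesis using assms by (auto simp: ext_eq_iff ext_hom_def not_le[symmetric])
qed

text \<open>Turns the vanishing of a top-degree form into one scalar equation.\<close>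

lemma ext_hom_top_cases:
  assumes "ext_hom (2 * CARD('n)) (\<phi> :: 'n::{finite,linorder} ext)"
  shows "\<phi> = 0 \<longleftrightarrow> \<phi> $ UNIV = 0"
proof -
  have "S = UNIV" if "card S = 2 * CARD('n)" for S :: "'n cogen set"
    using that by (metis card_UNIV_cogen card_subset_eq finite subset_UNIV)
  then show ?thesis using assms by (auto simp: ext_eq_iff ext_hom_def)
qed

lemma ext_hom_grade_inv: "ext_hom d \<phi> \<Longrightarrow> grade_inv \<phi> = (-1) ^ d *s \<phi>"
  by (auto simp: ext_eq_iff ext_hom_def grade_inv_def)

lemma gen_wedge_single: "ext_gen x = ext_gen x \<and>\<^sub>e emono {}"
  by simp

text \<open>Passing two generators applies the parity automorphism twice, hence not at all. It makes
  the fundamental form central.\<close>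

lemma gen_gen_wedge_commute:
  "\<phi> \<and>\<^sub>e ext_gen x \<and>\<^sub>e ext_gen y = (ext_gen x \<and>\<^sub>e ext_gen y) \<and>\<^sub>e \<phi>"
proof -
  have "(ext_gen x \<and>\<^sub>e ext_gen y) \<and>\<^sub>e \<phi> = ext_gen x \<and>\<^sub>e grade_inv \<phi> \<and>\<^sub>e ext_gen y"
    by (simp add: wedge_assoc gen_wedge_commute[of y])
  also have "\<dots> = (ext_gen x \<and>\<^sub>e grade_inv \<phi>) \<and>\<^sub>e ext_gen y"
    by (simp add: wedge_assoc)
  also have "\<dots> = (grade_inv (grade_inv \<phi>) \<and>\<^sub>e ext_gen x) \<and>\<^sub>e ext_gen y"
    by (subst gen_wedge_commute) simp
  also have "grade_inv (grade_inv \<phi>) = \<phi>"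
    by (simp add: grade_inv_def ext_eq_iff flip: mult.assoc power_add mult_2)
  finally show ?thesis by (simp add: wedge_assoc)
qed

lemma fund_alt: "fund H = (\<Sum>i\<in>UNIV. \<Sum>j\<in>UNIV. (\<i> * H $ i $ j) *s (ext_gen (DZ i) \<and>\<^sub>e ext_gen (DZB j)))"
  by (simp add: fund_def ext_gen_def)

lemma ext_hom_fund: "ext_hom 2 (fund H)"
  unfolding fund_alt using ext_hom_wedge[OF ext_hom_gen ext_hom_gen]
  by (auto intro!: ext_hom_sum ext_hom_scale simp: numeral_2_eq_2)

lemma fund_commute: "\<phi> \<and>\<^sub>e fund H = fund H \<and>\<^sub>e \<phi>"
  by (simp add: fund_alt wedge_sum_left wedge_sum_right wedge_scale_left wedge_scale_right
      gen_gen_wedge_commute)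

lemma fund_left_commute: "\<phi> \<and>\<^sub>e fund H \<and>\<^sub>e \<psi> = fund H \<and>\<^sub>e \<phi> \<and>\<^sub>e \<psi>"
  by (metis fund_commute wedge_assoc)

lemma ext_hom_power: "ext_hom (2 * p) (wedge_power (fund H) p)"
proof (induction p)
  case (Suc p)
  then show ?case using ext_hom_wedge[OF ext_hom_fund Suc] by simp
qed (simp add: ext_hom_one)

text \<open>Dividing by the factorial absorbs the integer factor in \<open>J_power\<close>, so the
  Wick rule has the same coefficient for every exponent.\<close>

definition fund_dp :: "'n cmat \<Rightarrow> nat \<Rightarrow> 'n::{finite,linorder} ext" where
  "fund_dp H p = (1 / fact p) *s wedge_power (fund H) p"

lemma fund_dp_0 [simp]: "fund_dp H 0 = emono {}"
  by (simp add: fund_dp_def)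

lemma fund_dp_1: "fund_dp H (Suc 0) = fund H"
  by (simp add: fund_dp_def)

lemma vol_eq: "vol H = fund_dp H CARD('n)" for H :: "'n::{finite,linorder} cmat"
  by (simp add: vol_def fund_dp_def)

lemma ext_hom_dp: "ext_hom (2 * p) (fund_dp H p)"
  unfolding fund_dp_def by (intro ext_hom_scale ext_hom_power)

lemma fund_dp_eq_0: "p > CARD('n) \<Longrightarrow> fund_dp (H :: 'n::{finite,linorder} cmat) p = 0"
  by (rule ext_hom_eq_0[OF ext_hom_dp]) simp

lemma dual_contr_gen: "dual_contr H x (ext_gen y) = cnj (cogen_inner H x y) *s emono {}"
  using dual_contr_gen_wedge[of H x y "emono {}"] by simp

lemma cogen_swap_swap [simp]: "cogen_swap (cogen_swap x) = x"
  by (cases x) auto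

text \<open>Chosen so that \<open>J (cogen_swap y) \<omega> = wick_coeff y *s ext_gen y\<close>.\<close>
fun wick_coeff :: "'n cogen \<Rightarrow> complex" where
  "wick_coeff (DZ i) = - \<i>"
| "wick_coeff (DZB i) = \<i>"

lemma wick_coeff_sq [simp]: "wick_coeff x * wick_coeff x = -1" "wick_coeff x * (wick_coeff x * z) = - z"
  by (cases x; simp)+

lemma cnj_wick_coeff_swap [simp]: "cnj (wick_coeff (cogen_swap x)) = wick_coeff x"
  by (cases x) auto

lemma matrix_inv_mult:
  fixes H :: "'n::finite cmat"
  assumes "invertible H"
  shows "H ** matrix_inv H = Finite_Cartesian_Product.mat 1"
    and "matrix_inv H ** H = Finite_Cartesian_Product.mat 1"
proof -
  have "\<exists>B. H ** B = Finite_Cartesian_Product.mat 1 \<and> B ** H = Finite_Cartesian_Product.mat 1"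
    using assms by (simp add: invertible_def)
  from someI_ex[OF this] show "H ** matrix_inv H = Finite_Cartesian_Product.mat 1"
    "matrix_inv H ** H = Finite_Cartesian_Product.mat 1"
    by (simp_all add: matrix_inv_def)
qed

section \<open>Inverse metric, Wick rule and Hodge star at a point\<close>

locale hermitian_matrix =
  fixes H :: "'n::{finite,linorder} cmat"
  assumes herm: "cnj (H $ i $ j) = H $ j $ i" and inv: "invertible H"
begin

abbreviation "g \<equiv> hup H"
abbreviation "G \<equiv> cogen_inner H"
abbreviation "J \<equiv> dual_contr H"
abbreviation "\<omega> \<equiv> fund H"
abbreviation "\<Omega> \<equiv> fund_dp H"
abbreviation "v \<equiv> vol H $ UNIV"

lemma hup_mult_left: "(\<Sum>j\<in>UNIV. g i j * H $ k $ j) = (if k = i then 1 else 0)"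
proof -
  have "(H ** matrix_inv H) $ k $ i = (if k = i then 1 else 0)"
    by (simp add: matrix_inv_mult[OF inv] Finite_Cartesian_Product.mat_def)
  then show ?thesis
    by (simp add: matrix_matrix_mult_def hup_def Finite_Cartesian_Product.transpose_def mult.commute)
qed

lemma hup_mult_right: "(\<Sum>k\<in>UNIV. g k i * H $ k $ j) = (if i = j then 1 else 0)"
proof -
  have "(matrix_inv H ** H) $ i $ j = (if i = j then 1 else 0)"
    by (simp add: matrix_inv_mult[OF inv] Finite_Cartesian_Product.mat_def)
  then show ?thesis
    by (simp add: matrix_matrix_mult_def hup_def Finite_Cartesian_Product.transpose_def)
qed

text \<open>A Kronecker delta, written as a product of the inverse with \<open>H\<close>, is
  inserted; summing in the other order and using \<open>herm\<close> reveals the conjugate of the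
  same relation.\<close>

lemma cnj_hup: "cnj (g i j) = g j i"
proof -
  have "cnj (g i j) = (\<Sum>l\<in>UNIV. cnj (g i l) * (\<Sum>k\<in>UNIV. g j k * H $ l $ k))"
    by (simp add: hup_mult_left if_distrib cong: if_cong)
  also have "\<dots> = (\<Sum>k\<in>UNIV. g j k * (\<Sum>l\<in>UNIV. cnj (g i l * H $ k $ l)))"
    unfolding sum_distrib_left by (subst sum.swap) (simp add: herm mult_ac)
  also have "\<dots> = (\<Sum>k\<in>UNIV. g j k * cnj (\<Sum>l\<in>UNIV. g i l * H $ k $ l))" by simp
  also have "\<dots> = g j i"
    unfolding hup_mult_left by (simp add: if_distrib cong: if_cong)
  finally show ?thesis .
qed

lemma cnj_G: "cnj (G x y) = G y x"
  by (cases x; cases y) (auto simp: cnj_hup)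

lemma J_gen_wedge: "J x (ext_gen y \<and>\<^sub>e \<phi>) = G y x *s \<phi> - ext_gen y \<and>\<^sub>e J x \<phi>"
  by (simp add: dual_contr_gen_wedge cnj_G)

lemma J_gen: "J x (ext_gen y) = G y x *s emono {}"
  by (simp add: dual_contr_gen cnj_G)

text \<open>This adjunction precedes Hermitian symmetry of the inner product and yields it: in
  \<open>cnj_ext_inner\<close> generators are peeled from one argument until only the constant term
  is left.\<close>

lemma ext_inner_gen_wedge_right: "ext_inner H \<phi> (ext_gen x \<and>\<^sub>e \<psi>) = ext_inner H (J x \<phi>) \<psi>"
proof (induction \<phi> arbitrary: \<psi> rule: ext_gen_induct)
  case one
  then show ?case by (simp add: ext_gen_wedge_nth)
next
  case (gen y \<phi>)
  then show ?case
    by (simp add: ext_inner_gen_wedge_left J_gen_wedge ext_inner_diff_left ext_inner_diff_right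
        ext_inner_scale_left ext_inner_scale_right cnj_G)
qed (auto simp: ext_inner_add_left dual_contr_add ext_inner_scale_left dual_contr_scale)

lemma ext_inner_one_right: "ext_inner H \<phi> (emono {}) = \<phi> $ {}"
  by (induction \<phi> rule: ext_gen_induct)
    (auto simp: ext_inner_gen_wedge_left ext_gen_wedge_nth ext_inner_add_left ext_inner_scale_left emono_nth)

lemma cnj_ext_inner: "cnj (ext_inner H \<phi> \<psi>) = ext_inner H \<psi> \<phi>"
  by (induction \<phi> arbitrary: \<psi> rule: ext_gen_induct)
    (auto simp: ext_inner_gen_wedge_left ext_inner_gen_wedge_right ext_inner_one_right
      ext_inner_add_left ext_inner_scale_left ext_inner_add_right ext_inner_scale_right)

text \<open>The coefficients of \<omega> meet their own inverse, so one generator survives. Its sign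
  is negative for \<open>DZ\<close> because the contracted generator stands in second place.\<close>

lemma J_fund: "J (cogen_swap y) \<omega> = wick_coeff y *s ext_gen y"
proof (cases y)
  case (DZB b)
  have "J (DZ b) \<omega> = (\<Sum>i\<in>UNIV. \<Sum>j\<in>UNIV. (\<i> * (g i b * H $ i $ j)) *s ext_gen (DZB j))"
    by (simp add: fund_alt dual_contr_sum dual_contr_scale J_gen_wedge J_gen mult_ac wedge_scale_right)
  also have "\<dots> = (\<Sum>j\<in>UNIV. (\<i> * (\<Sum>i\<in>UNIV. g i b * H $ i $ j)) *s ext_gen (DZB j))"
    by (subst sum.swap) (simp add: sum_distrib_left vec.scale_sum_left)
  also have "\<dots> = (\<Sum>j\<in>UNIV. if j = b then \<i> *s ext_gen (DZB j) else 0)"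
    by (intro sum.cong) (auto simp: hup_mult_right)
  finally show ?thesis using DZB by simp
next
  case (DZ a)
  have "J (DZB a) \<omega> = (\<Sum>i\<in>UNIV. \<Sum>j\<in>UNIV. (- \<i> * (g a j * H $ i $ j)) *s ext_gen (DZ i))"
    by (simp add: fund_alt dual_contr_sum dual_contr_scale J_gen_wedge J_gen mult_ac wedge_scale_right cnj_hup)
  also have "\<dots> = (\<Sum>i\<in>UNIV. (- \<i> * (\<Sum>j\<in>UNIV. g a j * H $ i $ j)) *s ext_gen (DZ i))"
    by (simp add: sum_distrib_left vec.scale_sum_left sum_negf)
  also have "\<dots> = (\<Sum>i\<in>UNIV. if i = a then - \<i> *s ext_gen (DZ i) else 0)"
    by (intro sum.cong) (auto simp: hup_mult_left)
  finally show ?thesis using DZ by simp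
qed

lemma J_power:
  "J (cogen_swap y) (wedge_power \<omega> (Suc p))
     = (of_nat (Suc p) * wick_coeff y) *s (ext_gen y \<and>\<^sub>e wedge_power \<omega> p)"
proof (induction p)
  case 0
  then show ?case by (simp add: J_fund)
next
  case (Suc p)
  have gr: "grade_inv \<omega> = \<omega>" using ext_hom_grade_inv[OF ext_hom_fund] by simp
  show ?case
    unfolding wedge_power.simps(2)[of _ "Suc p"] dual_contr_wedge Suc J_fund gr
    by (simp add: wedge_scale_left wedge_scale_right fund_left_commute[of "ext_gen y"] wedge_assoc)
      (simp add: ext_eq_iff algebra_simps)
qed

lemma J_dp: "J (cogen_swap y) (\<Omega> (Suc p)) = wick_coeff y *s (ext_gen y \<and>\<^sub>e \<Omega> p)"
  unfolding fund_dp_def dual_contr_scale J_power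
  using of_nat_neq_0[of p, where 'a = complex] by (simp add: ext_eq_iff wedge_scale_right divide_simps)

lemma J_dp': "J y (\<Omega> (Suc p)) = wick_coeff (cogen_swap y) *s (ext_gen (cogen_swap y) \<and>\<^sub>e \<Omega> p)"
  using J_dp[of "cogen_swap y" p] by simp

lemma wick:
  "(ext_gen y \<and>\<^sub>e \<theta> \<and>\<^sub>e \<Omega> p) $ UNIV = wick_coeff y * (J (cogen_swap y) \<theta> \<and>\<^sub>e \<Omega> (Suc p)) $ UNIV"
proof -
  have "0 = J (cogen_swap y) (\<theta> \<and>\<^sub>e \<Omega> (Suc p)) $ UNIV" by simp
  also have "\<dots> = (J (cogen_swap y) \<theta> \<and>\<^sub>e \<Omega> (Suc p)) $ UNIV
      + wick_coeff y * (grade_inv \<theta> \<and>\<^sub>e ext_gen y \<and>\<^sub>e \<Omega> p) $ UNIV"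
    by (simp add: dual_contr_wedge J_dp wedge_scale_right)
  \<comment> \<open>The parity sign of the Leibniz rule is exactly the one needed to bring the
    generator to the front.\<close>
  also have "grade_inv \<theta> \<and>\<^sub>e ext_gen y \<and>\<^sub>e \<Omega> p = ext_gen y \<and>\<^sub>e \<theta> \<and>\<^sub>e \<Omega> p"
    by (metis gen_wedge_commute wedge_assoc)
  finally have "(J (cogen_swap y) \<theta> \<and>\<^sub>e \<Omega> (Suc p)) $ UNIV = - (wick_coeff y * (ext_gen y \<and>\<^sub>e \<theta> \<and>\<^sub>e \<Omega> p) $ UNIV)"
    by (simp add: eq_neg_iff_add_eq_0)
  then show ?thesis by simp
qed

text \<open>Both sides obey the same recursion when a generator is peeled off
  \<open>\<theta>\<close>: on the left it becomes a contraction of \<open>\<Omega>\<close>, hence a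
  swapped generator that moves back by adjointness; on the right the Wick rule gives the same
  contraction of \<open>\<theta>\<close>.\<close>

lemma ext_inner_dp:
  assumes "m \<le> CARD('n)"
  shows "ext_inner H \<theta> (\<Omega> m) * v = (\<theta> \<and>\<^sub>e \<Omega> (CARD('n) - m)) $ UNIV"
  using assms
proof (induction m arbitrary: \<theta>)
  case 0
  \<comment> \<open>A peeled generator leaves \<open>\<Omega>\<close> with exponent above the
    dimension, which is zero; only the constant term of \<open>\<theta>\<close> contributes.\<close>
  show ?case
    by (induction \<theta> rule: ext_gen_induct)
      (auto simp: vol_eq ext_inner_gen_wedge_left wedge_assoc wick fund_dp_eq_0 ext_inner_add_left
        ext_inner_scale_left wedge_add_left wedge_scale_left emono_nth algebra_simps)
next
  case (Suc m)
  show ?case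
  proof (induction \<theta> rule: ext_gen_induct)
    case one
    have "\<Omega> (Suc m) $ {} = 0" using ext_hom_dp[of "Suc m" H] by (auto simp: ext_hom_def)
    moreover have "\<Omega> (CARD('n) - Suc m) $ UNIV = 0"
      by (rule ext_hom_top_eq_0[OF ext_hom_dp]) (use Suc.prems in auto)
    ultimately show ?case by simp
  next
    case (gen y \<theta>)
    have "Suc (CARD('n) - Suc m) = CARD('n) - m" using Suc.prems by simp
    then show ?case using Suc.IH[of "J (cogen_swap y) \<theta>"] Suc.prems
      by (simp add: ext_inner_gen_wedge_left J_dp' ext_inner_scale_right ext_inner_gen_wedge_right
          wedge_assoc wick)
  qed (auto simp: ext_inner_add_left ext_inner_scale_left wedge_add_left wedge_scale_left algebra_simps)
qed

text \<open>If the volume vanished, \<open>ext_inner_dp\<close> with \<open>m = n\<close> would kill every top-degree form.\<close>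
lemma vol_nonzero: "v \<noteq> 0"
proof
  assume "v = 0"
  then have "(emono UNIV \<and>\<^sub>e \<Omega> (CARD('n) - CARD('n))) $ UNIV = 0"
    using ext_inner_dp[of "CARD('n)" "emono UNIV"] by simp
  then show False by (simp add: emono_nth)
qed

text \<open>The wedge pairing into top degree is nondegenerate: testing against
  \<open>emono (- S)\<close> reads off the coefficient at \<open>S\<close> up to sign. This settles
  uniqueness in the definite description.\<close>

lemma hodge_star_eqI:
  assumes "\<And>\<phi>. (\<phi> \<and>\<^sub>e \<xi>) $ UNIV = ext_inner H \<phi> (ext_cnj \<psi>) * v"
  shows "hodge_star H \<psi> = \<xi>"
  unfolding hodge_star_def
proof (rule the_equality)
  show "\<forall>\<phi>. (\<phi> \<and>\<^sub>e \<xi>) $ UNIV = ext_inner H \<phi> (ext_cnj \<psi>) * v" using assms by blast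
next
  fix \<zeta> assume "\<forall>\<phi>. (\<phi> \<and>\<^sub>e \<zeta>) $ UNIV = ext_inner H \<phi> (ext_cnj \<psi>) * v"
  then have *: "(\<phi> \<and>\<^sub>e \<zeta>) $ UNIV = (\<phi> \<and>\<^sub>e \<xi>) $ UNIV" for \<phi> using assms by simp
  have "\<zeta> $ S = \<xi> $ S" for S
  proof -
    have w: "(emono (- S) \<and>\<^sub>e \<eta>) $ UNIV = shuffle_sign (- S) S * \<eta> $ S" for \<eta>
    proof -
      have "(emono (- S) \<and>\<^sub>e \<eta>) $ UNIV = (\<Sum>K\<in>Pow UNIV. if K = - S then shuffle_sign (- S) S * \<eta> $ S else 0)"
        unfolding wedge_def vec_lambda_beta by (rule sum.cong) (auto simp: emono_nth Compl_eq_Diff_UNIV[symmetric])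
      then show ?thesis by simp
    qed
    have "shuffle_sign (- S) S \<noteq> 0" by (simp add: shuffle_sign_def)
    then show ?thesis using *[of "emono (- S)"] by (simp add: w)
  qed
  then show "\<zeta> = \<xi>" by (simp add: ext_eq_iff)
qed

end

section \<open>Complex conjugation as a ring homomorphism\<close>

lemma ext_cnj_add: "ext_cnj (a + b) = ext_cnj a + ext_cnj b"
  by (simp add: ext_cnj_def ext_eq_iff algebra_simps)

lemma ext_cnj_scale: "ext_cnj (c *s a) = cnj c *s ext_cnj a"
  by (simp add: ext_cnj_def ext_eq_iff)

lemma ext_cnj_sum: "ext_cnj (\<Sum>i\<in>A. f i) = (\<Sum>i\<in>A. ext_cnj (f i))"
proof (induction A rule: infinite_finite_induct)
  case (infinite A)
  then show ?case by (simp add: ext_cnj_def ext_eq_iff)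
next
  case empty
  then show ?case by (simp add: ext_cnj_def ext_eq_iff)
qed (auto simp: ext_cnj_add)

lemma inj_cogen_swap: "inj cogen_swap"
  by (metis cogen_swap_swap injI)

lemma cogen_swap_image_swap [simp]: "cogen_swap ` cogen_swap ` S = S"
  by (simp add: image_comp o_def)

lemma cogen_swap_image_range: "cogen_swap ` range DZ = range DZB" "cogen_swap ` range DZB = range DZ"
  by (simp_all add: image_image)

lemma card_swap_Int_range:
  "card (cogen_swap ` S \<inter> range DZ) = card (S \<inter> range DZB)"
  "card (cogen_swap ` S \<inter> range DZB) = card (S \<inter> range DZ)"
proof -
  have "cogen_swap ` S \<inter> range DZ = cogen_swap ` (S \<inter> range DZB)"
    "cogen_swap ` S \<inter> range DZB = cogen_swap ` (S \<inter> range DZ)"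
    by (simp_all only: image_Int[OF inj_cogen_swap] cogen_swap_image_range)
  then show "card (cogen_swap ` S \<inter> range DZ) = card (S \<inter> range DZB)"
    "card (cogen_swap ` S \<inter> range DZB) = card (S \<inter> range DZ)"
    by (simp_all add: card_image inj_on_subset[OF inj_cogen_swap])
qed

lemma ext_cnj_emono:
  "ext_cnj (emono S) = (-1) ^ (card (S \<inter> range DZ) * card (S \<inter> range DZB)) *s emono (cogen_swap ` S)"
proof -
  have "cogen_swap ` T = S \<longleftrightarrow> T = cogen_swap ` S" for T by auto
  then show ?thesis by (auto simp: ext_cnj_def ext_eq_iff emono_nth card_swap_Int_range mult.commute)
qed

text \<open>All \<open>DZ\<close> generators precede \<open>DZB i\<close> and cause the extra sign;
  the remaining predecessors correspond under the swap to those of \<open>DZ i\<close>.\<close>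

lemma gen_sign_DZB:
  fixes S :: "'n::{finite,linorder} cogen set"
  shows "gen_sign (DZB i) S = (-1) ^ card (S \<inter> range DZ) * gen_sign (DZ i) (cogen_swap ` S)"
proof -
  have lt: "DZ a < DZB b" "DZ a < DZ b \<longleftrightarrow> a < b" "DZB a < DZB b \<longleftrightarrow> a < b" "\<not> DZB a < DZ b" for a b :: 'n
    by (auto simp: less_cogen_def)
  have "{b \<in> S. b < DZB i} = (S \<inter> range DZ) \<union> {b \<in> S \<inter> range DZB. b < DZB i}"
    (is "?A = ?B \<union> ?C")
  proof -
    have "b < DZB i \<longleftrightarrow> b \<in> range DZ \<or> (b \<in> range DZB \<and> b < DZB i)" for b by (cases b) (auto simp: lt)
    then show ?thesis by auto
  qed
  moreover have "?B \<inter> ?C = {}" by auto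
  moreover have "card ?C = card {b \<in> cogen_swap ` S. b < DZ i}"
  proof -
    have "{b \<in> cogen_swap ` S. b < DZ i} = cogen_swap ` ?C"
    proof (intro equalityI subsetI)
      fix b assume "b \<in> {b \<in> cogen_swap ` S. b < DZ i}"
      then show "b \<in> cogen_swap ` ?C"
        by (cases b) (auto simp: lt image_iff; metis cogen_swap.simps cogen_swap_swap lt)+
    next
      fix b assume "b \<in> cogen_swap ` ?C"
      then show "b \<in> {b \<in> cogen_swap ` S. b < DZ i}"
        by (auto simp: lt image_iff)
    qed
    then show ?thesis by (simp add: card_image inj_on_subset[OF inj_cogen_swap])
  qed
  ultimately show ?thesis by (simp add: gen_sign_def card_Un_disjoint power_add)
qed

lemma ext_cnj_one [simp]: "ext_cnj (emono {}) = emono {}"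
  by (simp add: ext_cnj_emono)

text \<open>A new generator changes the reordering sign of \<open>ext_cnj\<close> by the parity of
  the number of generators of the other type, which is the discrepancy found in
  \<open>gen_sign_DZB\<close>.\<close>

lemma ext_cnj_gen_wedge: "ext_cnj (ext_gen x \<and>\<^sub>e a) = ext_gen (cogen_swap x) \<and>\<^sub>e ext_cnj a"
proof (induction a rule: ext_mono_induct)
  case (1 S)
  have m: "cogen_swap x \<in> cogen_swap ` S \<longleftrightarrow> x \<in> S" by (simp add: inj_image_mem_iff inj_cogen_swap)
  show ?case
  proof (cases "x \<in> S")
    case True
    then show ?thesis
      by (simp add: ext_gen_wedge_emono ext_cnj_emono wedge_scale_right m) (simp add: ext_eq_iff ext_cnj_def)
  next
    case False
    show ?thesis
    proof (cases x)
      case (DZ i)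
      have "insert (DZ i) S \<inter> range DZ = insert (DZ i) (S \<inter> range DZ)"
        "insert (DZ i) S \<inter> range DZB = S \<inter> range DZB" by auto
      moreover have "gen_sign (DZB i) (cogen_swap ` S) = (-1) ^ card (S \<inter> range DZB) * gen_sign (DZ i) S"
        by (simp add: gen_sign_DZB card_swap_Int_range)
      moreover have "cnj (gen_sign (DZ i) S) = gen_sign (DZ i) S" by (simp add: gen_sign_def)
      ultimately show ?thesis using False m
        by (simp add: DZ ext_gen_wedge_emono ext_cnj_emono ext_cnj_scale wedge_scale_right power_add mult_ac)
    next
      case (DZB i)
      have "insert (DZB i) S \<inter> range DZB = insert (DZB i) (S \<inter> range DZB)"
        "insert (DZB i) S \<inter> range DZ = S \<inter> range DZ" by auto
      moreover have "cnj (gen_sign (DZ i) T) = gen_sign (DZ i) T" for T by (simp add: gen_sign_def)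
      moreover have "(-1) ^ k * ((-1) ^ k * z) = (z :: complex)" for k z
        by (simp flip: mult.assoc power_add mult_2)
      ultimately show ?thesis using False m
        by (simp add: DZB ext_gen_wedge_emono ext_cnj_emono ext_cnj_scale wedge_scale_right power_add
            gen_sign_DZB mult_ac)
    qed
  qed
qed (auto simp: wedge_add_right wedge_scale_right ext_cnj_add ext_cnj_scale)

lemma ext_cnj_wedge: "ext_cnj (a \<and>\<^sub>e b) = ext_cnj a \<and>\<^sub>e ext_cnj b"
  by (induction a rule: ext_gen_induct)
    (auto simp: ext_cnj_gen_wedge wedge_assoc wedge_add_left wedge_scale_left ext_cnj_add ext_cnj_scale)

lemma ext_cnj_gen: "ext_cnj (ext_gen x) = ext_gen (cogen_swap x)"
  using ext_cnj_gen_wedge[of x "emono {}"] by simp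

lemma ext_cnj_cnj [simp]: "ext_cnj (ext_cnj a) = (a :: 'n::{finite,linorder} ext)"
  by (induction a rule: ext_gen_induct) (auto simp: ext_cnj_gen_wedge ext_cnj_add ext_cnj_scale)

text \<open>Conjugating the imaginary unit and exchanging the two generators each give a minus sign;
  what remains is the conjugate transpose.\<close>

lemma ext_cnj_fund: "ext_cnj (fund M) = fund (\<chi> i j. cnj (M $ j $ i))"
proof -
  have *: "ext_gen (DZB i) \<and>\<^sub>e ext_gen (DZ j) = - (ext_gen (DZ j) \<and>\<^sub>e ext_gen (DZB i))" for i j :: 'a
    using wedge_gen_gen_anti[of "DZB i" "DZ j" "emono {}"] by simp
  have "ext_cnj (fund M) = (\<Sum>i\<in>UNIV. \<Sum>j\<in>UNIV. (\<i> * cnj (M $ i $ j)) *s (ext_gen (DZ j) \<and>\<^sub>e ext_gen (DZB i)))"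
    by (simp add: fund_alt ext_cnj_sum ext_cnj_scale ext_cnj_gen_wedge ext_cnj_gen *)
  also have "\<dots> = fund (\<chi> i j. cnj (M $ j $ i))" unfolding fund_alt by (subst sum.swap) simp
  finally show ?thesis .
qed

context hermitian_matrix
begin

lemma ext_cnj_omega: "ext_cnj \<omega> = \<omega>"
  by (simp add: ext_cnj_fund herm)

lemma ext_cnj_dp: "ext_cnj (\<Omega> p) = \<Omega> p"
proof -
  have "ext_cnj (wedge_power \<omega> p) = wedge_power \<omega> p"
    by (induction p) (auto simp: ext_cnj_wedge ext_cnj_omega)
  then show ?thesis by (simp add: fund_dp_def ext_cnj_scale)
qed

lemma hodge_star_dp: "m \<le> CARD('n) \<Longrightarrow> hodge_star H (\<Omega> m) = \<Omega> (CARD('n) - m)"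
  by (rule hodge_star_eqI) (simp add: ext_cnj_dp ext_inner_dp)

end

section \<open>Torsion and Hessian forms\<close>

text \<open>With \<open>M i\<close> the \<partial>-derivative of the metric matrix in direction
  \<open>i\<close>, this is \<partial>\<omega>.\<close>

definition tors_form :: "('n \<Rightarrow> 'n cmat) \<Rightarrow> 'n::{finite,linorder} ext" where
  "tors_form M = (\<Sum>i\<in>UNIV. ext_gen (DZ i) \<and>\<^sub>e fund (M i))"

text \<open>With \<open>B i j\<close> the mixed second derivatives of the metric matrix, this is
  \<partial> of the conjugate derivative of \<omega>.\<close>

definition hess_form :: "('n \<Rightarrow> 'n \<Rightarrow> 'n cmat) \<Rightarrow> 'n::{finite,linorder} ext" where
  "hess_form B = (\<Sum>i\<in>UNIV. \<Sum>j\<in>UNIV. ext_gen (DZ i) \<and>\<^sub>e ext_gen (DZB j) \<and>\<^sub>e fund (B i j))"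

text \<open>A common index pattern for all terms quadratic in first derivatives, so that they can be
  compared through their kernels.\<close>

definition tors_sum ::
    "('n \<Rightarrow> 'n cmat) \<Rightarrow> ('n \<Rightarrow> 'n \<Rightarrow> 'n \<Rightarrow> 'n \<Rightarrow> 'n \<Rightarrow> 'n::finite \<Rightarrow> complex) \<Rightarrow> complex" where
  "tors_sum M K = (\<Sum>i\<in>UNIV. \<Sum>p\<in>UNIV. \<Sum>q\<in>UNIV. \<Sum>j\<in>UNIV. \<Sum>s\<in>UNIV. \<Sum>r\<in>UNIV.
     M i $ p $ q * cnj (M j $ s $ r) * K i p q j s r)"

lemma tors_form_alt:
  "tors_form M = (\<Sum>i\<in>UNIV. \<Sum>p\<in>UNIV. \<Sum>q\<in>UNIV.
     (\<i> * M i $ p $ q) *s (ext_gen (DZ i) \<and>\<^sub>e ext_gen (DZ p) \<and>\<^sub>e ext_gen (DZB q)))"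
  by (simp add: tors_form_def fund_alt wedge_sum_right wedge_scale_right)

lemma cnj_tors_form_alt:
  "ext_cnj (tors_form M) = (\<Sum>i\<in>UNIV. \<Sum>p\<in>UNIV. \<Sum>q\<in>UNIV.
     (- \<i> * cnj (M i $ p $ q)) *s (ext_gen (DZB i) \<and>\<^sub>e ext_gen (DZB p) \<and>\<^sub>e ext_gen (DZ q)))"
  by (simp add: tors_form_alt ext_cnj_sum ext_cnj_scale ext_cnj_gen_wedge ext_cnj_gen)

context hermitian_matrix
begin

lemma wick':
  "((ext_gen y \<and>\<^sub>e \<theta>) \<and>\<^sub>e \<Omega> p) $ UNIV = wick_coeff y * (J (cogen_swap y) \<theta> \<and>\<^sub>e \<Omega> (Suc p)) $ UNIV"
  by (simp add: wedge_assoc wick)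

lemma wick_rev:
  "(J y \<theta> \<and>\<^sub>e \<Omega> (Suc p)) $ UNIV = - wick_coeff (cogen_swap y) * ((ext_gen (cogen_swap y) \<and>\<^sub>e \<theta>) \<and>\<^sub>e \<Omega> p) $ UNIV"
  using wick'[of "cogen_swap y" \<theta> p] by simp

text \<open>The two contractions of \<open>\<partial>_i h_{pq} cnj (\<partial>_j h_{sr})\<close> that give \<open>|\<partial>\<omega>|^2\<close> and \<open>|\<partial>^*\<omega>|^2\<close>.\<close>
definition norm_kernel where "norm_kernel i p q j s r = (g i j * g p s - g i s * g p j) * g r q"

definition trace_kernel where
  "trace_kernel i p q j s r = g p q * g r s * g i j - g i q * g r s * g p j - g p q * g r j * g i s
     + g i q * g r j * g p s"

lemma ext_norm2_tors: "ext_norm2 H (tors_form M) = tors_sum M norm_kernel"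
proof -
  have *: "ext_inner H (ext_gen (DZ i) \<and>\<^sub>e ext_gen (DZ p) \<and>\<^sub>e ext_gen (DZB q))
      (ext_gen (DZ j) \<and>\<^sub>e ext_gen (DZ s) \<and>\<^sub>e ext_gen (DZB r)) = norm_kernel i p q j s r" for i p q j s r
    \<comment> \<open>The appended unit lets the last generator be peeled by the same adjunction as
      the others.\<close>
    by (subst gen_wedge_single[of "DZB q"])
      (simp add: ext_inner_gen_wedge_left J_gen_wedge J_gen cnj_hup norm_kernel_def wedge_scale_right
        dual_contr_diff dual_contr_scale emono_nth algebra_simps del: wedge_one_right)
  have left: "ext_inner H (tors_form M) \<psi> = (\<Sum>i\<in>UNIV. \<Sum>p\<in>UNIV. \<Sum>q\<in>UNIV. \<i> * M i $ p $ q *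
      ext_inner H (ext_gen (DZ i) \<and>\<^sub>e ext_gen (DZ p) \<and>\<^sub>e ext_gen (DZB q)) \<psi>)" for \<psi>
    unfolding tors_form_alt ext_inner_sum_left ext_inner_scale_left ..
  have right: "ext_inner H (ext_gen (DZ i) \<and>\<^sub>e ext_gen (DZ p) \<and>\<^sub>e ext_gen (DZB q)) (tors_form M)
     = (\<Sum>j\<in>UNIV. \<Sum>s\<in>UNIV. \<Sum>r\<in>UNIV. cnj (\<i> * M j $ s $ r) * norm_kernel i p q j s r)" for i p q
    unfolding tors_form_alt ext_inner_sum_right ext_inner_scale_right * ..
  show ?thesis
    unfolding ext_norm2_def left right tors_sum_def sum_distrib_left
    by (intro sum.cong refl) (simp add: algebra_simps)
qed

text \<open>Each use of the Wick rule removes two generators and raises the exponent of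
  \<open>\<Omega>\<close> by one, so two uses reach the volume coefficient.\<close>

lemma hess_top:
  fixes B :: "'n \<Rightarrow> 'n \<Rightarrow> 'n cmat"
  assumes "CARD('n) = Suc (Suc m)"
  shows "(hess_form B \<and>\<^sub>e \<Omega> m) $ UNIV = - \<i> * v * (\<Sum>i\<in>UNIV. \<Sum>j\<in>UNIV. \<Sum>k\<in>UNIV. \<Sum>l\<in>UNIV.
     B i j $ k $ l * (g i j * g k l - g i l * g k j))"
proof -
  have v: "\<Omega> (Suc (Suc m)) $ UNIV = v" using assms by (simp add: vol_eq)
  have *: "((ext_gen (DZ i) \<and>\<^sub>e ext_gen (DZB j) \<and>\<^sub>e ext_gen (DZ k) \<and>\<^sub>e ext_gen (DZB l)) \<and>\<^sub>e \<Omega> m) $ UNIV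
     = - v * (g i j * g k l - g i l * g k j)" for i j k l
    by (simp add: wick' J_gen_wedge J_gen cnj_hup wedge_scale_right wedge_scale_left wedge_diff_left
        wedge_diff_right wedge_minus_left wedge_add_left dual_contr_diff dual_contr_add dual_contr_minus
        dual_contr_scale v algebra_simps)
  have "(hess_form B \<and>\<^sub>e \<Omega> m) $ UNIV = (\<Sum>i\<in>UNIV. \<Sum>j\<in>UNIV. \<Sum>k\<in>UNIV. \<Sum>l\<in>UNIV.
     \<i> * B i j $ k $ l * ((ext_gen (DZ i) \<and>\<^sub>e ext_gen (DZB j) \<and>\<^sub>e ext_gen (DZ k) \<and>\<^sub>e ext_gen (DZB l)) \<and>\<^sub>e \<Omega> m) $ UNIV)"
    by (simp add: hess_form_def fund_alt wedge_sum_left wedge_sum_right wedge_scale_left wedge_scale_right)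
  then show ?thesis unfolding * sum_distrib_left by (simp add: algebra_simps)
qed

text \<open>Three Wick steps pair the holomorphic indices \<open>i\<close>, \<open>p\<close>,
  \<open>r\<close> with \<open>q\<close>, \<open>j\<close>, \<open>s\<close>. The two pairings that
  match \<open>r\<close> with \<open>q\<close> form \<open>norm_kernel\<close>; the other four form
  \<open>trace_kernel\<close>.\<close>

lemma tors_top:
  fixes M :: "'n \<Rightarrow> 'n cmat"
  assumes "CARD('n) = Suc (Suc (Suc m))"
  shows "(tors_form M \<and>\<^sub>e ext_cnj (tors_form M) \<and>\<^sub>e \<Omega> m) $ UNIV
    = \<i> * v * (tors_sum M norm_kernel - tors_sum M trace_kernel)"
proof -
  have v: "\<Omega> (Suc (Suc (Suc m))) $ UNIV = v" using assms by (simp add: vol_eq)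
  have *: "((ext_gen (DZ i) \<and>\<^sub>e ext_gen (DZ p) \<and>\<^sub>e ext_gen (DZB q) \<and>\<^sub>e
       ext_gen (DZB j) \<and>\<^sub>e ext_gen (DZB s) \<and>\<^sub>e ext_gen (DZ r)) \<and>\<^sub>e \<Omega> m) $ UNIV
     = \<i> * v * (norm_kernel i p q j s r - trace_kernel i p q j s r)" for i p q j s r
    by (simp add: wick' J_gen_wedge J_gen cnj_hup wedge_scale_right wedge_scale_left wedge_diff_left
        wedge_diff_right wedge_minus_left wedge_add_left dual_contr_diff dual_contr_add dual_contr_minus
        dual_contr_scale v norm_kernel_def trace_kernel_def algebra_simps)
  have left: "(tors_form M \<and>\<^sub>e \<psi>) $ UNIV = (\<Sum>i\<in>UNIV. \<Sum>p\<in>UNIV. \<Sum>q\<in>UNIV. \<i> * M i $ p $ q *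
      ((ext_gen (DZ i) \<and>\<^sub>e ext_gen (DZ p) \<and>\<^sub>e ext_gen (DZB q)) \<and>\<^sub>e \<psi>) $ UNIV)" for \<psi>
    by (simp add: tors_form_alt wedge_sum_left wedge_scale_left mult.assoc)
  have right: "((ext_gen (DZ i) \<and>\<^sub>e ext_gen (DZ p) \<and>\<^sub>e ext_gen (DZB q)) \<and>\<^sub>e ext_cnj (tors_form M) \<and>\<^sub>e \<Omega> m) $ UNIV
     = (\<Sum>j\<in>UNIV. \<Sum>s\<in>UNIV. \<Sum>r\<in>UNIV. - \<i> * cnj (M j $ s $ r) *
       (\<i> * v * (norm_kernel i p q j s r - trace_kernel i p q j s r)))" for i p q
    unfolding *[symmetric] cnj_tors_form_alt wedge_sum_left wedge_sum_right sum_component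
      wedge_scale_left wedge_scale_right vector_smult_component wedge_assoc ..
  show ?thesis
    unfolding left right tors_sum_def sum_subtractf[symmetric] sum_distrib_left
    by (intro sum.cong refl) (simp add: algebra_simps)
qed

text \<open>The three generators move to \<open>\<phi>\<close> as contractions, and the Wick rule
  read backwards turns contractions into generators again until a single one is left. This prepares
  the Hodge star of a form of degree 2n-1.\<close>

lemma ext_inner_top3:
  assumes "2 \<le> CARD('n)"
  shows "ext_inner H \<phi> ((ext_gen (DZ i) \<and>\<^sub>e ext_gen (DZ p) \<and>\<^sub>e ext_gen (DZB q)) \<and>\<^sub>e \<Omega> (CARD('n) - 2)) * v
    = g q i * (\<phi> \<and>\<^sub>e ext_gen (DZB p)) $ UNIV - g q p * (\<phi> \<and>\<^sub>e ext_gen (DZB i)) $ UNIV"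
proof -
  have comm: "ext_gen y \<and>\<^sub>e J x \<psi> = G y x *s \<psi> - J x (ext_gen y \<and>\<^sub>e \<psi>)" for x y \<psi>
    by (simp add: J_gen_wedge)
  \<comment> \<open>Only the part of \<open>\<phi>\<close> of degree 2n-1 contributes, and that
    degree is odd.\<close>
  have sgn: "(ext_gen x \<and>\<^sub>e \<phi>) $ UNIV = - (\<phi> \<and>\<^sub>e ext_gen x) $ UNIV" for x
  proof -
    have "(ext_gen x \<and>\<^sub>e \<phi>) $ UNIV = (grade_inv \<phi> \<and>\<^sub>e ext_gen x) $ UNIV"
      by (simp add: gen_wedge_commute[of x])
    also have "grade_inv \<phi> \<and>\<^sub>e ext_gen x = - grade_inv (\<phi> \<and>\<^sub>e ext_gen x)"
      using ext_hom_grade_inv[OF ext_hom_gen, of x] by (simp add: grade_inv_wedge wedge_minus_right)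
    finally show ?thesis by (simp add: grade_inv_def card_UNIV_cogen)
  qed
  have w1: "(J (DZ k) \<psi> \<and>\<^sub>e \<Omega> (Suc 0)) $ UNIV = - \<i> * (ext_gen (DZB k) \<and>\<^sub>e \<psi>) $ UNIV" for k \<psi>
    using wick_rev[of "DZ k" \<psi> 0] by simp
  have w2: "(J (DZB q) \<psi> \<and>\<^sub>e \<Omega> (Suc (Suc 0))) $ UNIV = \<i> * ((ext_gen (DZ q) \<and>\<^sub>e \<psi>) \<and>\<^sub>e \<Omega> (Suc 0)) $ UNIV" for \<psi>
    using wick_rev[of "DZB q" \<psi> "Suc 0"] by simp
  \<comment> \<open>Turning the outer contraction into \<open>DZB p\<close> leaves an inner
    contraction by \<open>DZ i\<close>, which pairs to zero with it and otherwise has no top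
    coefficient.\<close>
  have z: "(J (DZ p) (J (DZ i) \<psi>) \<and>\<^sub>e \<Omega> (Suc 0)) $ UNIV = 0" for \<psi>
    by (simp add: w1 comm[of "DZB p"])
  have "ext_inner H \<phi> ((ext_gen (DZ i) \<and>\<^sub>e ext_gen (DZ p) \<and>\<^sub>e ext_gen (DZB q)) \<and>\<^sub>e \<Omega> (CARD('n) - 2)) * v
      = (J (DZB q) (J (DZ p) (J (DZ i) \<phi>)) \<and>\<^sub>e \<Omega> (Suc (Suc 0))) $ UNIV"
    using ext_inner_dp[of "CARD('n) - 2"] assms
    by (simp add: wedge_assoc ext_inner_gen_wedge_right numeral_2_eq_2)
  also have "\<dots> = \<i> * (g q p * (J (DZ i) \<phi> \<and>\<^sub>e \<Omega> (Suc 0)) $ UNIV - g q i * (J (DZ p) \<phi> \<and>\<^sub>e \<Omega> (Suc 0)) $ UNIV)"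
    by (simp add: w2 comm[of "DZ q"] dual_contr_diff dual_contr_scale wedge_diff_left wedge_add_left
        wedge_scale_left z algebra_simps)
  also have "\<dots> = g q i * (\<phi> \<and>\<^sub>e ext_gen (DZB p)) $ UNIV - g q p * (\<phi> \<and>\<^sub>e ext_gen (DZB i)) $ UNIV"
    by (simp add: w1 sgn algebra_simps)
  finally show ?thesis .
qed

text \<open>This is \<open>- \<partial>^*\<omega>\<close> when \<open>tors_form M = \<partial>\<omega>\<close>.\<close>
definition lee_form where
  "lee_form M = (\<Sum>i\<in>UNIV. \<Sum>p\<in>UNIV. \<Sum>q\<in>UNIV. (\<i> * cnj (M i $ p $ q)) *s
     (g q p *s ext_gen (DZB i) - g q i *s ext_gen (DZB p)))"

lemma hodge_star_tors:
  assumes "2 \<le> CARD('n)"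
  shows "hodge_star H (ext_cnj (tors_form M) \<and>\<^sub>e \<Omega> (CARD('n) - 2)) = lee_form M"
proof (rule hodge_star_eqI)
  fix \<phi>
  show "(\<phi> \<and>\<^sub>e lee_form M) $ UNIV
    = ext_inner H \<phi> (ext_cnj (ext_cnj (tors_form M) \<and>\<^sub>e \<Omega> (CARD('n) - 2))) * v"
    unfolding lee_form_def ext_cnj_wedge ext_cnj_cnj ext_cnj_dp tors_form_alt wedge_sum_left
      wedge_sum_right ext_inner_sum_right sum_distrib_right sum_component wedge_scale_left
      ext_inner_scale_right mult.assoc ext_inner_top3[OF assms]
    by (intro sum.cong refl) (simp add: wedge_scale_right wedge_diff_right algebra_simps)
qed

lemma ext_norm2_lee: "ext_norm2 H (lee_form M) = tors_sum M trace_kernel"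
proof -
  have *: "ext_inner H (ext_gen (DZB i)) (ext_gen (DZB j)) = g j i" for i j
    by (subst gen_wedge_single[of "DZB i"])
      (simp add: ext_inner_gen_wedge_left J_gen cnj_hup ext_inner_scale_right emono_nth del: wedge_one_right)
  have **: "ext_inner H (g q p *s ext_gen (DZB i) - g q i *s ext_gen (DZB p))
      (g r s *s ext_gen (DZB j) - g r j *s ext_gen (DZB s)) = cnj (trace_kernel i p q j s r)" for i p q j s r
    by (simp add: ext_inner_diff_left ext_inner_diff_right ext_inner_scale_left ext_inner_scale_right *
        trace_kernel_def cnj_hup algebra_simps)
  let ?w = "\<lambda>i p q. g q p *s ext_gen (DZB i) - g q i *s ext_gen (DZB p)"
  have left: "ext_inner H (lee_form M) \<psi> = (\<Sum>i\<in>UNIV. \<Sum>p\<in>UNIV. \<Sum>q\<in>UNIV. \<i> * cnj (M i $ p $ q) *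
      ext_inner H (?w i p q) \<psi>)" for \<psi>
    unfolding lee_form_def ext_inner_sum_left ext_inner_scale_left ..
  have right: "ext_inner H (?w i p q) (lee_form M) = (\<Sum>j\<in>UNIV. \<Sum>s\<in>UNIV. \<Sum>r\<in>UNIV.
      cnj (\<i> * cnj (M j $ s $ r)) * cnj (trace_kernel i p q j s r))" for i p q
    unfolding lee_form_def ext_inner_sum_right ext_inner_scale_right ** ..
  \<comment> \<open>The (0,1)-generators produce the conjugated kernel; a squared norm equals its
    conjugate, so this is harmless.\<close>
  have "ext_norm2 H (lee_form M) = cnj (ext_norm2 H (lee_form M))"
    by (simp add: ext_norm2_def cnj_ext_inner)
  also have "\<dots> = tors_sum M trace_kernel"
    unfolding ext_norm2_def left right tors_sum_def sum_distrib_left cnj_sum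
    by (intro sum.cong refl) (simp add: algebra_simps)
  finally show ?thesis .
qed

end

section \<open>Wirtinger calculus\<close>

text \<open>The parameter covers both types, \<open>c = - \<i>\<close> and \<open>c = \<i>\<close>,
  so each calculus rule is proved once and conjugation just conjugates \<open>c\<close>.\<close>

definition wirtinger :: "complex \<Rightarrow> 'n::finite \<Rightarrow> ('n cvec \<Rightarrow> complex) \<Rightarrow> 'n cvec \<Rightarrow> complex" where
  "wirtinger c i f z = (frechet_derivative f (at z) (axis i 1) + c * frechet_derivative f (at z) (axis i \<i>)) / 2"

lemma dpart_wirtinger: "dpart = wirtinger (- \<i>)"
  by (intro ext) (simp add: dpart_def wirtinger_def)

lemma dbarpart_wirtinger: "dbarpart = wirtinger \<i>"
  by (intro ext) (simp add: dbarpart_def wirtinger_def)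

lemma wirtinger_eq:
  assumes "(f has_derivative f') (at z)"
  shows "wirtinger c i f z = (f' (axis i 1) + c * f' (axis i \<i>)) / 2"
  by (simp add: wirtinger_def frechet_derivative_at[OF assms, symmetric])

lemma wirtinger_const [simp]: "wirtinger c i (\<lambda>w. k) z = 0"
  by (subst wirtinger_eq[OF has_derivative_const]) simp

lemma wirtinger_add:
  assumes "f differentiable (at z)" "g differentiable (at z)"
  shows "wirtinger c i (\<lambda>w. f w + g w) z = wirtinger c i f z + wirtinger c i g z"
  using assms[unfolded frechet_derivative_works]
  by (subst wirtinger_eq[OF has_derivative_add]) (auto simp: wirtinger_def algebra_simps add_divide_distrib)

lemma wirtinger_mult:
  assumes "f differentiable (at z)" "g differentiable (at z)"
  shows "wirtinger c i (\<lambda>w. f w * g w) z = wirtinger c i f z * g z + f z * wirtinger c i g z"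
  using assms[unfolded frechet_derivative_works]
  by (subst wirtinger_eq[OF has_derivative_mult]) (auto simp: wirtinger_def field_simps)

lemma wirtinger_cmult:
  assumes "f differentiable (at z)"
  shows "wirtinger c i (\<lambda>w. k * f w) z = k * wirtinger c i f z"
  using wirtinger_mult[OF differentiable_const assms, of c i k] by simp

lemma wirtinger_sum:
  assumes "\<And>k. k \<in> A \<Longrightarrow> f k differentiable (at z)"
  shows "wirtinger c i (\<lambda>w. \<Sum>k\<in>A. f k w) z = (\<Sum>k\<in>A. wirtinger c i (f k) z)"
  using assms
proof (induction A rule: infinite_finite_induct)
  case (insert x A)
  then have "(\<lambda>w. \<Sum>k\<in>A. f k w) differentiable (at z)"
    by (intro differentiable_sum) auto
  then show ?case using insert by (simp add: wirtinger_add)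
qed auto

lemma wirtinger_cnj:
  assumes "f differentiable (at z)"
  shows "wirtinger c i (\<lambda>w. cnj (f w)) z = cnj (wirtinger (cnj c) i f z)"
  by (subst wirtinger_eq[OF has_derivative_cnj[OF assms[unfolded frechet_derivative_works]]])
    (simp add: wirtinger_def)

text \<open>The identities to be differentiated, such as Hermitian symmetry and the inverse
  relation, hold on the open chart image only.\<close>

lemma wirtinger_cong_open:
  assumes "open U" "z \<in> U" "\<And>w. w \<in> U \<Longrightarrow> f w = g w"
  shows "wirtinger c i f z = wirtinger c i g z"
proof -
  have "(f has_derivative D) (at z) \<longleftrightarrow> (g has_derivative D) (at z)" for D
    using has_derivative_transform_within_open[of f D z UNIV U g]
      has_derivative_transform_within_open[of g D z UNIV U f] assms by auto
  then show ?thesis by (simp add: wirtinger_def frechet_derivative_def)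
qed

section \<open>Coefficientwise derivatives of forms\<close>

definition ext_differentiable :: "'n::{finite,linorder} cform \<Rightarrow> 'n cvec \<Rightarrow> bool" where
  "ext_differentiable \<phi> z \<longleftrightarrow> (\<forall>S. (\<lambda>w. \<phi> w $ S) differentiable (at z))"

definition ext_wirtinger :: "complex \<Rightarrow> 'n \<Rightarrow> 'n::{finite,linorder} cform \<Rightarrow> 'n cform" where
  "ext_wirtinger c i \<phi> z = (\<chi> S. wirtinger c i (\<lambda>w. \<phi> w $ S) z)"

lemma del_alt: "del \<phi> z = (\<Sum>i\<in>UNIV. ext_gen (DZ i) \<and>\<^sub>e ext_wirtinger (- \<i>) i \<phi> z)"
  by (simp add: del_def ext_wirtinger_def ext_gen_def dpart_wirtinger)

lemma delbar_alt: "delbar \<phi> z = (\<Sum>i\<in>UNIV. ext_gen (DZB i) \<and>\<^sub>e ext_wirtinger \<i> i \<phi> z)"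
  by (simp add: delbar_def ext_wirtinger_def ext_gen_def dbarpart_wirtinger)

lemma ext_differentiable_const [simp]: "ext_differentiable (\<lambda>w. a) z"
  by (simp add: ext_differentiable_def)

lemma ext_wirtinger_const [simp]: "ext_wirtinger c i (\<lambda>w. a) z = 0"
  by (simp add: ext_wirtinger_def ext_eq_iff)

lemma ext_differentiable_wedge:
  assumes "ext_differentiable a z" "ext_differentiable b z"
  shows "ext_differentiable (\<lambda>w. a w \<and>\<^sub>e b w) z"
  using assms unfolding ext_differentiable_def wedge_def vec_lambda_beta
  by (intro allI differentiable_sum ballI differentiable_mult) auto

lemma ext_wirtinger_wedge:
  assumes "ext_differentiable a z" "ext_differentiable b z"
  shows "ext_wirtinger c i (\<lambda>w. a w \<and>\<^sub>e b w) z = ext_wirtinger c i a z \<and>\<^sub>e b z + a z \<and>\<^sub>e ext_wirtinger c i b z"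
proof -
  have d: "(\<lambda>w. a w $ S) differentiable (at z)" "(\<lambda>w. b w $ S) differentiable (at z)" for S
    using assms by (auto simp: ext_differentiable_def)
  have t: "wirtinger c i (\<lambda>w. \<sigma> * a w $ I * b w $ K) z
      = \<sigma> * wirtinger c i (\<lambda>w. a w $ I) z * b z $ K + \<sigma> * a z $ I * wirtinger c i (\<lambda>w. b w $ K) z" for \<sigma> I K
    unfolding mult.assoc
    by (simp add: wirtinger_cmult wirtinger_mult differentiable_mult d distrib_left)
  have "ext_wirtinger c i (\<lambda>w. a w \<and>\<^sub>e b w) z $ S = (ext_wirtinger c i a z \<and>\<^sub>e b z + a z \<and>\<^sub>e ext_wirtinger c i b z) $ S" for S
    unfolding ext_wirtinger_def wedge_def vec_lambda_beta vector_add_component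
    by (subst wirtinger_sum) (auto simp: t sum.distrib d intro!: differentiable_mult)
  then show ?thesis by (simp add: ext_eq_iff)
qed

lemma ext_differentiable_sum:
  assumes "\<And>k. k \<in> A \<Longrightarrow> ext_differentiable (f k) z"
  shows "ext_differentiable (\<lambda>w. \<Sum>k\<in>A. f k w) z"
  using assms unfolding ext_differentiable_def sum_component
  by (cases "finite A") (auto intro!: differentiable_sum)

lemma ext_wirtinger_sum:
  assumes "\<And>k. k \<in> A \<Longrightarrow> ext_differentiable (f k) z"
  shows "ext_wirtinger c i (\<lambda>w. \<Sum>k\<in>A. f k w) z = (\<Sum>k\<in>A. ext_wirtinger c i (f k) z)"
  using assms
  by (simp add: ext_wirtinger_def ext_eq_iff sum_component ext_differentiable_def wirtinger_sum)

lemma ext_wirtinger_scale: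
  assumes "ext_differentiable a z"
  shows "ext_wirtinger c i (\<lambda>w. k *s a w) z = k *s ext_wirtinger c i a z"
  using assms
  by (simp add: ext_wirtinger_def ext_eq_iff ext_differentiable_def wirtinger_cmult)

lemma ext_wirtinger_cong_open:
  assumes "open U" "z \<in> U" "\<And>w. w \<in> U \<Longrightarrow> f w = g w"
  shows "ext_wirtinger c i f z = ext_wirtinger c i g z"
  unfolding ext_wirtinger_def ext_eq_iff vec_lambda_beta
  using assms by (auto intro!: wirtinger_cong_open[OF assms(1,2)])

definition mat_wirtinger :: "complex \<Rightarrow> ('n cvec \<Rightarrow> 'n cmat) \<Rightarrow> 'n cvec \<Rightarrow> 'n \<Rightarrow> 'n::finite cmat" where
  "mat_wirtinger c h z i = (\<chi> k l. wirtinger c i (\<lambda>w. h w $ k $ l) z)"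

lemma fund_nth: "fund M $ S = (\<Sum>i\<in>UNIV. \<Sum>j\<in>UNIV. (\<i> * (ext_gen (DZ i) \<and>\<^sub>e ext_gen (DZB j)) $ S) * M $ i $ j)"
  by (simp add: fund_alt mult_ac)

lemma ext_differentiable_fund:
  assumes "\<And>k l. (\<lambda>w. h w $ k $ l) differentiable (at z)"
  shows "ext_differentiable (\<lambda>w. fund (h w)) z"
  unfolding ext_differentiable_def fund_nth
  by (intro allI differentiable_sum ballI differentiable_mult assms) auto

lemma ext_wirtinger_fund:
  assumes "\<And>k l. (\<lambda>w. h w $ k $ l) differentiable (at z)"
  shows "ext_wirtinger c i (\<lambda>w. fund (h w)) z = fund (mat_wirtinger c h z i)"
  unfolding ext_eq_iff ext_wirtinger_def vec_lambda_beta fund_nth mat_wirtinger_def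
  using assms by (simp add: wirtinger_sum wirtinger_cmult differentiable_sum differentiable_mult)

lemma ext_differentiable_power:
  assumes "ext_differentiable a z"
  shows "ext_differentiable (\<lambda>w. wedge_power (a w) m) z"
  by (induction m) (auto simp: assms ext_differentiable_wedge)

lemma ext_wirtinger_power:
  assumes "\<And>k l. (\<lambda>w. h w $ k $ l) differentiable (at z)"
  shows "ext_wirtinger c i (\<lambda>w. wedge_power (fund (h w)) m) z
    = of_nat m *s (fund (mat_wirtinger c h z i) \<and>\<^sub>e wedge_power (fund (h z)) (m - 1))"
proof (induction m)
  case 0
  then show ?case by simp
next
  case (Suc m)
  note IH = this
  show ?case
  \<comment> \<open>Only for positive \<open>m\<close> does the leading factor recombine with the
    power of exponent \<open>m - 1\<close>.\<close>
  proof (cases m)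
    case 0
    then show ?thesis by (simp add: ext_wirtinger_fund[OF assms])
  next
    case (Suc l)
    have d: "ext_differentiable (\<lambda>w. fund (h w)) z" by (rule ext_differentiable_fund[OF assms])
    have "ext_wirtinger c i (\<lambda>w. wedge_power (fund (h w)) (Suc m)) z
      = fund (mat_wirtinger c h z i) \<and>\<^sub>e wedge_power (fund (h z)) m
       + fund (h z) \<and>\<^sub>e ext_wirtinger c i (\<lambda>w. wedge_power (fund (h w)) m) z"
      unfolding wedge_power.simps(2)
      by (simp add: ext_wirtinger_wedge[OF d ext_differentiable_power[OF d]] ext_wirtinger_fund[OF assms])
    also have "\<dots> = of_nat (Suc m) *s (fund (mat_wirtinger c h z i) \<and>\<^sub>e wedge_power (fund (h z)) m)"
      unfolding IH unfolding Suc
      by (simp add: wedge_scale_right wedge_add_right fund_left_commute[of "fund (mat_wirtinger c h z i)" "h z"])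
        (simp add: ext_eq_iff algebra_simps)
    finally show ?thesis by simp
  qed
qed

section \<open>Differentiability of the metric, its first derivatives and its inverse\<close>

lemma smooth_on_matrix:
  fixes h :: "'n::finite cvec \<Rightarrow> 'n cmat"
  assumes "open U" "smooth_on h U" "z \<in> U"
  shows smooth_on_matrix_entry: "(\<lambda>w. h w $ k $ l) differentiable (at z)"
    and smooth_on_matrix_wirtinger: "(\<lambda>w. wirtinger c i (\<lambda>u. h u $ k $ l) w) differentiable (at z)"
proof -
  have "Ck_on (Suc (Suc 0)) h U" using assms(2) by (simp add: smooth_on_def)
  then have d: "h differentiable (at w)" and d2: "(\<lambda>x. frechet_derivative h (at x) v) differentiable (at w)"
    if "w \<in> U" for w v using that by auto
  have entry: "(\<lambda>w. f w $ k $ l) differentiable (at w)" if "f differentiable (at w)" for f :: "'n cvec \<Rightarrow> 'n cmat" and w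
  proof -
    obtain D where "(f has_derivative D) (at w)" using \<open>f differentiable (at w)\<close> by (auto simp: differentiable_def)
    from bounded_linear.has_derivative[OF bounded_linear_vec_nth
        bounded_linear.has_derivative[OF bounded_linear_vec_nth this]]
    show ?thesis by (rule differentiableI)
  qed
  show "(\<lambda>w. h w $ k $ l) differentiable (at z)" using entry d assms(3) by blast
  have "((\<lambda>w. h w $ k $ l) has_derivative (\<lambda>v. frechet_derivative h (at w) v $ k $ l)) (at w)" if "w \<in> U" for w
    using bounded_linear.has_derivative[OF bounded_linear_vec_nth
        bounded_linear.has_derivative[OF bounded_linear_vec_nth d[OF that, unfolded frechet_derivative_works]]]
    by simp
  then have eq: "wirtinger c i (\<lambda>u. h u $ k $ l) w
      = (frechet_derivative h (at w) (axis i 1) $ k $ l + c * frechet_derivative h (at w) (axis i \<i>) $ k $ l) / 2"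
    if "w \<in> U" for w using that by (subst wirtinger_eq) auto
  have "(\<lambda>w. (frechet_derivative h (at w) (axis i 1) $ k $ l + c * frechet_derivative h (at w) (axis i \<i>) $ k $ l) * (1/2))
      differentiable (at z)"
    by (intro differentiable_mult differentiable_add differentiable_const entry d2 assms(3))
  then obtain D where D: "((\<lambda>w. (frechet_derivative h (at w) (axis i 1) $ k $ l
      + c * frechet_derivative h (at w) (axis i \<i>) $ k $ l) * (1/2)) has_derivative D) (at z)"
    by (auto simp: differentiable_def)
  have "((\<lambda>w. wirtinger c i (\<lambda>u. h u $ k $ l) w) has_derivative D) (at z)"
    by (rule has_derivative_transform_within_open[OF D assms(1,3)]) (simp add: eq)
  then show "(\<lambda>w. wirtinger c i (\<lambda>u. h u $ k $ l) w) differentiable (at z)"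
    by (rule differentiableI)
qed

lemma differentiable_prod:
  fixes f :: "'b \<Rightarrow> 'a::real_normed_vector \<Rightarrow> complex"
  assumes "\<And>k. k \<in> A \<Longrightarrow> f k differentiable (at z)"
  shows "(\<lambda>w. \<Prod>k\<in>A. f k w) differentiable (at z)"
  using assms by (induction A rule: infinite_finite_induct) (auto intro!: differentiable_mult)

lemma differentiable_det:
  fixes M :: "'a::real_normed_vector \<Rightarrow> complex^'n^'n::finite"
  assumes "\<And>k l. (\<lambda>w. M w $ k $ l) differentiable (at z)"
  shows "(\<lambda>w. Determinants.det (M w)) differentiable (at z)"
  unfolding Determinants.det_def
  by (intro differentiable_sum ballI differentiable_mult differentiable_const differentiable_prod assms)
    (auto simp: finite_permutations)

text \<open>Cramer's rule exhibits the inverse as a quotient of polynomials in the entries, whence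
  its differentiability.\<close>

lemma hup_cramer:
  fixes H :: "'n::finite cmat"
  assumes "invertible H"
  shows "hup H i j = Determinants.det (\<chi> a b. if b = j then (if a = i then 1 else 0) else H $ a $ b) / Determinants.det H"
proof -
  have "(H ** matrix_inv H) $ a $ i = axis i 1 $ a" for a
    by (simp add: matrix_inv_mult(1)[OF assms] Finite_Cartesian_Product.mat_def axis_def)
  then have "H *v column i (matrix_inv H) = axis i 1"
    by (simp add: Finite_Cartesian_Product.vec_eq_iff matrix_matrix_mult_def matrix_vector_mult_def column_def)
  moreover have "Determinants.det H \<noteq> 0" using assms by (simp add: invertible_det_nz)
  ultimately have "column i (matrix_inv H) = (\<chi> k. Determinants.det (\<chi> a b. if b = k then axis i 1 $ a else H $ a $ b) / Determinants.det H)"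
    by (simp add: cramer)
  then have "column i (matrix_inv H) $ j = Determinants.det (\<chi> a b. if b = j then axis i 1 $ a else H $ a $ b) / Determinants.det H"
    by simp
  then show ?thesis by (simp add: column_def hup_def Finite_Cartesian_Product.transpose_def axis_def cong: if_cong)
qed

lemma differentiable_hup:
  fixes h :: "'n::finite cvec \<Rightarrow> 'n cmat"
  assumes "open U" "z \<in> U" "\<And>k l. (\<lambda>w. h w $ k $ l) differentiable (at z)" "\<And>w. w \<in> U \<Longrightarrow> invertible (h w)"
  shows "(\<lambda>w. hup (h w) i j) differentiable (at z)"
proof -
  let ?q = "\<lambda>w. Determinants.det (\<chi> a b. if b = j then (if a = i then 1 else 0) else h w $ a $ b) / Determinants.det (h w)"
  have "?q differentiable (at z)"
  proof (intro differentiable_divide differentiable_det)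
    show "(\<lambda>w. (\<chi> a b. if b = j then (if a = i then 1 else 0) else h w $ a $ b) $ k $ l) differentiable (at z)" for k l
      by (cases "l = j") (simp_all add: assms(3))
    show "Determinants.det (h z) \<noteq> 0" using assms(2,4) by (simp add: invertible_det_nz)
  qed (rule assms(3))
  then obtain D where "(?q has_derivative D) (at z)" by (auto simp: differentiable_def)
  then have "((\<lambda>w. hup (h w) i j) has_derivative D) (at z)"
    by (rule has_derivative_transform_within_open[OF _ assms(1,2)]) (simp add: hup_cramer assms(4))
  then show ?thesis by (rule differentiableI)
qed

section \<open>The curvature identity in a chart\<close>

locale hermitian_chart =
  fixes h :: "'n::{finite,linorder} cvec \<Rightarrow> 'n cmat" and U :: "'n cvec set"
  assumes open_U: "open U" and smooth: "smooth_on h U"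
    and hermitian: "w \<in> U \<Longrightarrow> hermitian_matrix (h w)"
begin

lemma entry_diff: "z \<in> U \<Longrightarrow> (\<lambda>w. h w $ k $ l) differentiable (at z)"
  by (rule smooth_on_matrix_entry[OF open_U smooth])

lemma wirtinger_diff: "z \<in> U \<Longrightarrow> (\<lambda>w. wirtinger c i (\<lambda>u. h u $ k $ l) w) differentiable (at z)"
  by (rule smooth_on_matrix_wirtinger[OF open_U smooth])

lemma hup_diff: "z \<in> U \<Longrightarrow> (\<lambda>w. hup (h w) i j) differentiable (at z)"
  using hermitian by (intro differentiable_hup[OF open_U]) (auto intro: entry_diff simp: hermitian_matrix_def)

definition dh where "dh z i = mat_wirtinger (- \<i>) h z i"

text \<open>The order of the derivatives is that of \<open>del (delbar _)\<close>.\<close>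

definition ddh where
  "ddh z i j = (\<chi> k l. wirtinger (- \<i>) i (wirtinger \<i> j (\<lambda>u. h u $ k $ l)) z)"

text \<open>Hermitian symmetry on \<open>U\<close> turns antiholomorphic derivatives into conjugates
  of holomorphic ones, so \<open>dh\<close> holds all first-order data.\<close>

lemma wirtinger_bar_entry:
  assumes "z \<in> U"
  shows "wirtinger \<i> j (\<lambda>w. h w $ k $ l) z = cnj (dh z j $ l $ k)"
proof -
  have "wirtinger \<i> j (\<lambda>w. h w $ k $ l) z = wirtinger \<i> j (\<lambda>w. cnj (h w $ l $ k)) z"
    by (rule wirtinger_cong_open[OF open_U assms]) (simp add: hermitian_matrix.herm[OF hermitian])
  then show ?thesis using entry_diff[OF assms]
    by (simp add: wirtinger_cnj dh_def mat_wirtinger_def)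
qed

lemma del_fund: "z \<in> U \<Longrightarrow> del (fund_form h) z = tors_form (dh z)"
  by (simp add: del_alt fund_form_def[abs_def] ext_wirtinger_fund[OF entry_diff] tors_form_def dh_def)

lemma delbar_fund_sum:
  "z \<in> U \<Longrightarrow> ext_cnj (tors_form (dh z)) = (\<Sum>j\<in>UNIV. ext_gen (DZB j) \<and>\<^sub>e fund (mat_wirtinger \<i> h z j))"
  by (simp add: tors_form_def ext_cnj_sum ext_cnj_gen_wedge ext_cnj_fund mat_wirtinger_def
      wirtinger_bar_entry)

lemma delbar_power:
  assumes "z \<in> U"
  shows "delbar (\<lambda>w. wedge_power (fund_form h w) m) z
    = of_nat m *s (ext_cnj (tors_form (dh z)) \<and>\<^sub>e wedge_power (fund (h z)) (m - 1))"
  unfolding delbar_alt fund_form_def ext_wirtinger_power[OF entry_diff[OF assms]] delbar_fund_sum[OF assms]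
  by (simp add: wedge_sum_left wedge_scale_right wedge_assoc ext_eq_iff sum_distrib_left)

lemma ext_wirtinger_delbar_fund:
  assumes z: "z \<in> U"
  shows "ext_wirtinger (- \<i>) i (\<lambda>w. \<Sum>j\<in>UNIV. ext_gen (DZB j) \<and>\<^sub>e fund (mat_wirtinger \<i> h w j)) z
    = (\<Sum>j\<in>UNIV. ext_gen (DZB j) \<and>\<^sub>e fund (ddh z i j))"
    and "ext_differentiable (\<lambda>w. \<Sum>j\<in>UNIV. ext_gen (DZB j) \<and>\<^sub>e fund (mat_wirtinger \<i> h w j)) z"
proof -
  have e: "(\<lambda>w. mat_wirtinger \<i> h w j $ k $ l) differentiable (at z)" for j k l
    using wirtinger_diff[OF z] by (simp add: mat_wirtinger_def)
  have d: "ext_differentiable (\<lambda>w. fund (mat_wirtinger \<i> h w j)) z" for j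
    by (rule ext_differentiable_fund[OF e])
  have "mat_wirtinger (- \<i>) (\<lambda>w. mat_wirtinger \<i> h w j) z i = ddh z i j" for j
    by (simp add: mat_wirtinger_def ddh_def)
  then show "ext_wirtinger (- \<i>) i (\<lambda>w. \<Sum>j\<in>UNIV. ext_gen (DZB j) \<and>\<^sub>e fund (mat_wirtinger \<i> h w j)) z
    = (\<Sum>j\<in>UNIV. ext_gen (DZB j) \<and>\<^sub>e fund (ddh z i j))"
    by (simp add: ext_wirtinger_sum ext_differentiable_wedge d ext_wirtinger_wedge
        ext_wirtinger_fund[OF e])
  show "ext_differentiable (\<lambda>w. \<Sum>j\<in>UNIV. ext_gen (DZB j) \<and>\<^sub>e fund (mat_wirtinger \<i> h w j)) z"
    by (intro ext_differentiable_sum ext_differentiable_wedge d ext_differentiable_const)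
qed

lemma del_delbar_power:
  assumes z: "z \<in> U"
  shows "del (delbar (\<lambda>w. wedge_power (fund_form h w) m)) z
    = of_nat m *s (hess_form (ddh z) \<and>\<^sub>e wedge_power (fund (h z)) (m - 1)
       + of_nat (m - 1) *s (tors_form (dh z) \<and>\<^sub>e ext_cnj (tors_form (dh z)) \<and>\<^sub>e wedge_power (fund (h z)) (m - 2)))"
proof -
  let ?\<gamma> = "\<lambda>w. \<Sum>j\<in>UNIV. ext_gen (DZB j) \<and>\<^sub>e fund (mat_wirtinger \<i> h w j)"
  let ?p = "\<lambda>l. wedge_power (fund (h z)) l"
  have dp: "ext_differentiable (\<lambda>w. wedge_power (fund (h w)) l) z" for l
    by (intro ext_differentiable_power ext_differentiable_fund entry_diff z)
  have "ext_wirtinger (- \<i>) i (delbar (\<lambda>w. wedge_power (fund_form h w) m)) z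
    = ext_wirtinger (- \<i>) i (\<lambda>w. of_nat m *s (?\<gamma> w \<and>\<^sub>e wedge_power (fund (h w)) (m - 1))) z" for i
    by (rule ext_wirtinger_cong_open[OF open_U z]) (simp add: delbar_power delbar_fund_sum)
  also have "\<dots> i = of_nat m *s ((\<Sum>j\<in>UNIV. ext_gen (DZB j) \<and>\<^sub>e fund (ddh z i j)) \<and>\<^sub>e ?p (m - 1)
      + of_nat (m - 1) *s (?\<gamma> z \<and>\<^sub>e fund (dh z i) \<and>\<^sub>e ?p (m - 2)))" for i
  proof -
    have "m - 1 - 1 = m - 2" by simp
    then show ?thesis
      by (simp only: ext_wirtinger_scale[OF ext_differentiable_wedge[OF ext_wirtinger_delbar_fund(2)[OF z] dp]]
          ext_wirtinger_wedge[OF ext_wirtinger_delbar_fund(2)[OF z] dp] ext_wirtinger_delbar_fund(1)[OF z]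
          ext_wirtinger_power[OF entry_diff[OF z]] wedge_scale_right dh_def)
  qed
  \<comment> \<open>The derivative of \<omega> has even degree and moves to the front without a
    sign, ready to be joined with \<open>DZ i\<close> into \<open>tors_form\<close>.\<close>
  finally have eq: "ext_wirtinger (- \<i>) i (delbar (\<lambda>w. wedge_power (fund_form h w) m)) z
    = of_nat m *s ((\<Sum>j\<in>UNIV. ext_gen (DZB j) \<and>\<^sub>e fund (ddh z i j)) \<and>\<^sub>e ?p (m - 1)
      + of_nat (m - 1) *s (fund (dh z i) \<and>\<^sub>e ext_cnj (tors_form (dh z)) \<and>\<^sub>e ?p (m - 2)))" for i
    by (simp only: fund_left_commute delbar_fund_sum[OF z])
  show ?thesis
    unfolding del_alt eq
    by (simp add: hess_form_def tors_form_def[of "dh z"] wedge_sum_left wedge_sum_right wedge_scale_right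
        wedge_add_right wedge_assoc ext_eq_iff sum_distrib_left sum.distrib distrib_left)
qed

text \<open>The first star gives \<open>\<Omega> (n - 1)\<close>; differentiating a divided power
  lowers its exponent by one without a numerical factor; the second star is
  \<open>hodge_star_tors\<close>.\<close>

lemma del_adj_fund:
  assumes z: "z \<in> U" and n: "2 \<le> CARD('n)"
  shows "del_adj h (fund_form h) z = - hermitian_matrix.lee_form (h z) (dh z)"
proof -
  interpret hermitian_matrix "h z" by (rule hermitian[OF z])
  let ?n = "CARD('n)"
  \<comment> \<open>Needed on all of \<open>U\<close>, since the result is differentiated
    next.\<close>
  have s: "star_form h (fund_form h) w = (1 / fact (?n - 1)) *s wedge_power (fund (h w)) (?n - 1)" if "w \<in> U" for w
    using hermitian_matrix.hodge_star_dp[OF hermitian[OF that], of "Suc 0"] n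
    by (simp add: star_form_def fund_form_def fund_dp_1) (simp add: fund_dp_def)
  have "ext_wirtinger \<i> i (star_form h (fund_form h)) z
      = (1 / fact (?n - 1)) *s ext_wirtinger \<i> i (\<lambda>w. wedge_power (fund (h w)) (?n - 1)) z" for i
    by (subst ext_wirtinger_cong_open[OF open_U z s])
      (auto intro!: ext_wirtinger_scale ext_differentiable_power ext_differentiable_fund entry_diff z)
  then have "delbar (star_form h (fund_form h)) z
      = (1 / fact (?n - 1)) *s delbar (\<lambda>w. wedge_power (fund_form h w) (?n - 1)) z"
    by (simp add: delbar_alt wedge_scale_right fund_form_def vec.scale_sum_right)
  also have "\<dots> = ext_cnj (tors_form (dh z)) \<and>\<^sub>e \<Omega> (?n - 2)"
  proof -
    define l where "l = ?n - 2"
    then have l: "?n = Suc (Suc l)" using n by simp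
    have "(1 + of_nat l :: complex) \<noteq> 0" using of_nat_neq_0[of l, where 'a = complex] by simp
    then show ?thesis unfolding delbar_power[OF z] fund_dp_def
      by (simp add: l wedge_scale_right ext_eq_iff divide_simps) (simp add: algebra_simps)
  qed
  finally show ?thesis
    unfolding del_adj_def star_form_def[of h "delbar _"] by (simp add: hodge_star_tors[OF n])
qed

text \<open>Here \<open>ddh z j i\<close> has its two derivatives in the order opposite to \<open>curv\<close>: conjugation swaps them, so
  the symmetry of second derivatives is never needed.\<close>
lemma curv_eq:
  assumes z: "z \<in> U"
  shows "curv h i j k l z = (\<Sum>q\<in>UNIV. \<Sum>p\<in>UNIV. dh z i $ k $ q * cnj (dh z j $ l $ p) * hup (h z) p q)
    - cnj (ddh z j i $ l $ k)"
proof -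
  interpret hermitian_matrix "h z" by (rule hermitian[OF z])
  have dk: "wirtinger \<i> j (wirtinger (- \<i>) i (\<lambda>u. h u $ k $ q)) z = cnj (ddh z j i $ q $ k)" for q
  proof -
    have "wirtinger \<i> j (wirtinger (- \<i>) i (\<lambda>u. h u $ k $ q)) z
      = wirtinger \<i> j (\<lambda>w. cnj (wirtinger \<i> i (\<lambda>u. h u $ q $ k) w)) z"
      by (rule wirtinger_cong_open[OF open_U z]) (simp add: wirtinger_bar_entry dh_def mat_wirtinger_def)
    then show ?thesis using wirtinger_diff[OF z] by (simp add: wirtinger_cnj ddh_def)
  qed
  have chr: "wirtinger \<i> j (christoffel h i k p) z = (\<Sum>q\<in>UNIV. wirtinger \<i> j (\<lambda>w. hup (h w) p q) z * dh z i $ k $ q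
      + g p q * cnj (ddh z j i $ q $ k))" for p
    unfolding christoffel_def[abs_def] dpart_wirtinger
    by (subst wirtinger_sum)
      (auto simp: wirtinger_mult hup_diff wirtinger_diff z dk dh_def mat_wirtinger_def intro!: differentiable_mult)
  \<comment> \<open>The derivative of the inverse metric is found by differentiating the relation
    between the inverse and the metric.\<close>
  have dg: "(\<Sum>p\<in>UNIV. h z $ p $ l * wirtinger \<i> j (\<lambda>w. hup (h w) p q) z)
      = - (\<Sum>p\<in>UNIV. g p q * cnj (dh z j $ l $ p))" for q
  proof -
    have "0 = wirtinger \<i> j (\<lambda>w. if q = l then 1 else 0) z" by simp
    also have "\<dots> = wirtinger \<i> j (\<lambda>w. \<Sum>p\<in>UNIV. hup (h w) p q * h w $ p $ l) z"
      by (rule wirtinger_cong_open[OF open_U z]) (simp add: hermitian_matrix.hup_mult_right[OF hermitian])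
    also have "\<dots> = (\<Sum>p\<in>UNIV. wirtinger \<i> j (\<lambda>w. hup (h w) p q) z * h z $ p $ l + g p q * cnj (dh z j $ l $ p))"
      by (subst wirtinger_sum)
        (auto simp: wirtinger_mult hup_diff entry_diff z wirtinger_bar_entry intro!: differentiable_mult)
    finally show ?thesis by (simp add: sum.distrib eq_neg_iff_add_eq_0 mult.commute)
  qed
  have "curv h i j k l z = - (\<Sum>p\<in>UNIV. \<Sum>q\<in>UNIV. h z $ p $ l * wirtinger \<i> j (\<lambda>w. hup (h w) p q) z * dh z i $ k $ q
      + (g p q * h z $ p $ l) * cnj (ddh z j i $ q $ k))"
    by (simp add: curv_def dbarpart_wirtinger chr sum_distrib_left algebra_simps)
  also have "\<dots> = - (\<Sum>q\<in>UNIV. (\<Sum>p\<in>UNIV. h z $ p $ l * wirtinger \<i> j (\<lambda>w. hup (h w) p q) z) * dh z i $ k $ q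
      + (\<Sum>p\<in>UNIV. g p q * h z $ p $ l) * cnj (ddh z j i $ q $ k))"
    by (subst sum.swap) (simp add: sum.distrib sum_distrib_right)
  also have "\<dots> = (\<Sum>q\<in>UNIV. (\<Sum>p\<in>UNIV. g p q * cnj (dh z j $ l $ p)) * dh z i $ k $ q)
      - (\<Sum>q\<in>UNIV. (if q = l then 1 else 0) * cnj (ddh z j i $ q $ k))"
    unfolding dg hup_mult_right by (simp add: sum_subtractf)
  finally show ?thesis by (simp add: sum_distrib_left sum_distrib_right mult_ac if_distrib if_distribR cong: if_cong)
qed

definition hess_trace where
  "hess_trace z = (\<Sum>i\<in>UNIV. \<Sum>j\<in>UNIV. \<Sum>k\<in>UNIV. \<Sum>l\<in>UNIV.
     ddh z i j $ k $ l * (hup (h z) i j * hup (h z) k l - hup (h z) i l * hup (h z) k j))"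

text \<open>The two scalars contract one curvature tensor with kernels whose difference is that of
  \<open>hess_top\<close>. On the quadratic part of \<open>curv_eq\<close> the same
  antisymmetrisation produces the kernel of the squared norm of \<partial>\<omega>.\<close>

lemma scal_diff:
  assumes z: "z \<in> U"
  shows "scal h z - scal_hat h z
    = tors_sum (dh z) (hermitian_matrix.norm_kernel (h z)) - cnj (hess_trace z)"
proof -
  interpret hermitian_matrix "h z" by (rule hermitian[OF z])
  let ?c = "\<lambda>i j k l. g i j * g k l - g i l * g k j"
  let ?t = "\<lambda>i j k l q p. dh z i $ k $ q * cnj (dh z j $ l $ p) * (?c i j k l * g p q)"
  have "scal h z - scal_hat h z = (\<Sum>i\<in>UNIV. \<Sum>j\<in>UNIV. \<Sum>k\<in>UNIV. \<Sum>l\<in>UNIV. ?c i j k l * curv h i j k l z)"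
    by (simp add: scal_def scal_hat_def left_diff_distrib flip: sum_subtractf)
  also have "\<dots> = (\<Sum>i\<in>UNIV. \<Sum>j\<in>UNIV. \<Sum>k\<in>UNIV. \<Sum>l\<in>UNIV. (\<Sum>q\<in>UNIV. \<Sum>p\<in>UNIV. ?t i j k l q p)
      - ?c i j k l * cnj (ddh z j i $ l $ k))"
    unfolding curv_eq[OF z] right_diff_distrib sum_distrib_left
    by (intro sum.cong refl arg_cong2[of _ _ _ _ "(-)"]) (simp add: algebra_simps)
  also have "\<dots> = (\<Sum>i\<in>UNIV. \<Sum>j\<in>UNIV. \<Sum>k\<in>UNIV. \<Sum>l\<in>UNIV. \<Sum>q\<in>UNIV. \<Sum>p\<in>UNIV. ?t i j k l q p)
      - (\<Sum>i\<in>UNIV. \<Sum>j\<in>UNIV. \<Sum>k\<in>UNIV. \<Sum>l\<in>UNIV. ?c i j k l * cnj (ddh z j i $ l $ k))"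
    by (simp only: sum_subtractf)
  also have "(\<Sum>i\<in>UNIV. \<Sum>j\<in>UNIV. \<Sum>k\<in>UNIV. \<Sum>l\<in>UNIV. \<Sum>q\<in>UNIV. \<Sum>p\<in>UNIV. ?t i j k l q p)
      = tors_sum (dh z) norm_kernel"
  proof -
    have "(\<Sum>j\<in>UNIV. \<Sum>k\<in>UNIV. \<Sum>l\<in>UNIV. \<Sum>q\<in>UNIV. \<Sum>p\<in>UNIV. ?t i j k l q p)
      = (\<Sum>k\<in>UNIV. \<Sum>q\<in>UNIV. \<Sum>j\<in>UNIV. \<Sum>l\<in>UNIV. \<Sum>p\<in>UNIV. ?t i j k l q p)" for i
    proof -
      have "(\<Sum>j\<in>UNIV. \<Sum>k\<in>UNIV. \<Sum>l\<in>UNIV. \<Sum>q\<in>UNIV. \<Sum>p\<in>UNIV. ?t i j k l q p)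
        = (\<Sum>k\<in>UNIV. \<Sum>j\<in>UNIV. \<Sum>l\<in>UNIV. \<Sum>q\<in>UNIV. \<Sum>p\<in>UNIV. ?t i j k l q p)"
        by (rule sum.swap)
      also have "\<dots> = (\<Sum>k\<in>UNIV. \<Sum>j\<in>UNIV. \<Sum>q\<in>UNIV. \<Sum>l\<in>UNIV. \<Sum>p\<in>UNIV. ?t i j k l q p)"
        by (rule sum.cong[OF refl], rule sum.cong[OF refl], rule sum.swap)
      also have "\<dots> = (\<Sum>k\<in>UNIV. \<Sum>q\<in>UNIV. \<Sum>j\<in>UNIV. \<Sum>l\<in>UNIV. \<Sum>p\<in>UNIV. ?t i j k l q p)"
        by (rule sum.cong[OF refl], rule sum.swap)
      finally show ?thesis .
    qed
    then show ?thesis by (simp add: tors_sum_def norm_kernel_def)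
  qed
  \<comment> \<open>Exchanging \<open>i\<close> with \<open>j\<close> and \<open>k\<close> with
    \<open>l\<close> conjugates the kernel.\<close>
  also have "(\<Sum>i\<in>UNIV. \<Sum>j\<in>UNIV. \<Sum>k\<in>UNIV. \<Sum>l\<in>UNIV. ?c i j k l * cnj (ddh z j i $ l $ k)) = cnj (hess_trace z)"
  proof -
    have "(\<Sum>i\<in>UNIV. \<Sum>j\<in>UNIV. \<Sum>k\<in>UNIV. \<Sum>l\<in>UNIV. ?c i j k l * cnj (ddh z j i $ l $ k))
        = (\<Sum>j\<in>UNIV. \<Sum>i\<in>UNIV. \<Sum>k\<in>UNIV. \<Sum>l\<in>UNIV. ?c i j k l * cnj (ddh z j i $ l $ k))"
      by (rule sum.swap)
    also have "\<dots> = (\<Sum>j\<in>UNIV. \<Sum>i\<in>UNIV. \<Sum>l\<in>UNIV. \<Sum>k\<in>UNIV. ?c i j k l * cnj (ddh z j i $ l $ k))"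
      by (rule sum.cong[OF refl], rule sum.cong[OF refl], rule sum.swap)
    also have "\<dots> = cnj (hess_trace z)"
      unfolding hess_trace_def cnj_sum by (intro sum.cong refl) (simp add: cnj_hup mult_ac)
    finally show ?thesis .
  qed
  finally show ?thesis .
qed

lemma gauduchon_iff:
  assumes z: "z \<in> U" and n: "3 \<le> CARD('n)" and k: "1 \<le> k" "k \<le> CARD('n) - 1"
  shows "\<i> *s (del (delbar (\<lambda>w. wedge_power (fund_form h w) k)) z \<and>\<^sub>e wedge_power (fund_form h z) (CARD('n) - k - 1)) = 0
    \<longleftrightarrow> scal h z - scal_hat h z =
          of_real ((real k - 1) / (real CARD('n) - 2)) * ext_norm2 (h z) (del_adj h (fund_form h) z)
        + of_real ((real CARD('n) - 1 - real k) / (real CARD('n) - 2)) * ext_norm2 (h z) (del (fund_form h) z)"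
proof -
  interpret hermitian_matrix "h z" by (rule hermitian[OF z])
  define m where "m = CARD('n) - 3"
  then have m: "CARD('n) = Suc (Suc (Suc m))" using n by simp
  define \<beta> where "\<beta> = tors_form (dh z)"
  define N1 where "N1 = tors_sum (dh z) norm_kernel"
  define N2 where "N2 = tors_sum (dh z) trace_kernel"
  define Q where "Q = hess_trace z"
  have pow_add: "wedge_power \<omega> a \<and>\<^sub>e wedge_power \<omega> b = wedge_power \<omega> (a + b)" for a b
    by (induction a) (auto simp: wedge_assoc)
  let ?\<Phi> = "del (delbar (\<lambda>w. wedge_power (fund_form h w) k)) z \<and>\<^sub>e wedge_power (fund_form h z) (CARD('n) - k - 1)"
  have "?\<Phi> = of_nat k *s (hess_form (ddh z) \<and>\<^sub>e wedge_power \<omega> (Suc m)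
       + of_nat (k - 1) *s (\<beta> \<and>\<^sub>e ext_cnj \<beta> \<and>\<^sub>e wedge_power \<omega> m))"
  \<comment> \<open>For \<open>k = 1\<close> the exponent \<open>k - 2\<close> truncates and the
    powers would not add up to \<open>m\<close>, but the factor \<open>k - 1\<close> removes that
    term.\<close>
  proof (cases "k = 1")
    case True
    then show ?thesis
      unfolding del_delbar_power[OF z] by (simp add: fund_form_def m wedge_assoc)
  next
    case False
    then have "k - 1 + (CARD('n) - k - 1) = Suc m" "k - 2 + (CARD('n) - k - 1) = m"
      using k m by auto
    then show ?thesis
      unfolding del_delbar_power[OF z]
      by (simp add: fund_form_def \<beta>_def wedge_scale_left wedge_add_left wedge_diff_left wedge_assoc pow_add)
  qed
  \<comment> \<open>The two factorials differ by \<open>Suc m\<close>, which is n-2: the denominator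
    in the theorem.\<close>
  also have "\<dots> = (of_nat k * fact m) *s (of_nat (Suc m) *s (hess_form (ddh z) \<and>\<^sub>e \<Omega> (Suc m))
       + of_nat (k - 1) *s (\<beta> \<and>\<^sub>e ext_cnj \<beta> \<and>\<^sub>e \<Omega> m))"
  proof -
    have "wedge_power \<omega> a = fact a *s \<Omega> a" for a by (simp add: fund_dp_def)
    then show ?thesis
      by (simp add: wedge_scale_right vec.scale_right_distrib mult_ac del: of_nat_Suc wedge_power.simps)
  qed
  finally have \<Phi>: "?\<Phi> = (of_nat k * fact m) *s (of_nat (Suc m) *s (hess_form (ddh z) \<and>\<^sub>e \<Omega> (Suc m))
       + of_nat (k - 1) *s (\<beta> \<and>\<^sub>e ext_cnj \<beta> \<and>\<^sub>e \<Omega> m))" .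
  have hom3: "ext_hom 3 (ext_gen x \<and>\<^sub>e fund M)" for x :: "'n cogen" and M
    using ext_hom_wedge[OF ext_hom_gen ext_hom_fund, of x M] by (simp add: numeral_3_eq_3)
  have hom\<beta>: "ext_hom 3 \<beta>"
    unfolding \<beta>_def tors_form_def
    by (intro ext_hom_sum hom3)
  have hom\<gamma>: "ext_hom 3 (ext_cnj \<beta>)"
    unfolding \<beta>_def delbar_fund_sum[OF z]
    by (intro ext_hom_sum hom3)
  have "ext_hom 4 (hess_form (ddh z))"
    unfolding hess_form_def
    using ext_hom_wedge[OF ext_hom_gen hom3] by (intro ext_hom_sum) simp
  then have "ext_hom (2 * CARD('n)) (hess_form (ddh z) \<and>\<^sub>e \<Omega> (Suc m))"
    using ext_hom_wedge[OF _ ext_hom_dp, of 4 "hess_form (ddh z)" "Suc m" "h z"]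
    by (simp add: m eval_nat_numeral)
  moreover have "ext_hom (2 * CARD('n)) (\<beta> \<and>\<^sub>e ext_cnj \<beta> \<and>\<^sub>e \<Omega> m)"
    using ext_hom_wedge[OF hom\<beta> ext_hom_wedge[OF hom\<gamma> ext_hom_dp, of m "h z"]]
    by (simp add: m eval_nat_numeral)
  ultimately have "ext_hom (2 * CARD('n)) (\<i> *s ?\<Phi>)"
    unfolding \<Phi> by (intro ext_hom_scale ext_hom_add)
  then have "\<i> *s ?\<Phi> = 0 \<longleftrightarrow> (\<i> *s ?\<Phi>) $ UNIV = 0" by (rule ext_hom_top_cases)
  also have "(\<i> *s ?\<Phi>) $ UNIV = \<i> * (of_nat k * fact m) * (\<i> * v * (of_nat (k - 1) * (N1 - N2) - of_nat (Suc m) * Q))"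
    unfolding \<Phi> \<beta>_def by (simp add: hess_top[of "Suc m"] tors_top m N1_def N2_def Q_def hess_trace_def algebra_simps)
  also have "\<dots> = 0 \<longleftrightarrow> of_nat (Suc m) * Q = of_nat (k - 1) * (N1 - N2)"
    using vol_nonzero k by auto
  also have "\<dots> \<longleftrightarrow> of_nat (Suc m) * cnj Q = of_nat (k - 1) * (N1 - N2)"
  proof -
    have "cnj N1 = N1" unfolding N1_def ext_norm2_tors[symmetric] by (simp add: ext_norm2_def cnj_ext_inner)
    moreover have "cnj N2 = N2" unfolding N2_def ext_norm2_lee[symmetric] by (simp add: ext_norm2_def cnj_ext_inner)
    ultimately have "cnj (of_nat (k - 1) * (N1 - N2)) = of_nat (k - 1) * (N1 - N2)" by simp
    moreover have "cnj (of_nat (Suc m) * Q) = of_nat (Suc m) * cnj Q" by (simp del: of_nat_Suc)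
    ultimately show ?thesis by (metis complex_cnj_cnj)
  qed
  also have "\<dots> \<longleftrightarrow> N1 - cnj Q = of_real ((real k - 1) / (real CARD('n) - 2)) * N2
        + of_real ((real CARD('n) - 1 - real k) / (real CARD('n) - 2)) * N1"
  proof -
    \<comment> \<open>With s = n-2 and t = k-1 the second numerator n-1-k is s-t, so the claim is
      linear algebra in N_1, N_2 and the conjugate of Q.\<close>
    define s :: complex where "s = of_nat (Suc m)"
    define t :: complex where "t = of_nat (k - 1)"
    have s0: "s \<noteq> 0" by (simp add: s_def del: of_nat_Suc)
    have c: "complex_of_real ((real k - 1) / (real CARD('n) - 2)) = t / s"
      "complex_of_real ((real CARD('n) - 1 - real k) / (real CARD('n) - 2)) = (s - t) / s"
      using k by (simp_all add: s_def t_def m of_nat_diff)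
    show ?thesis unfolding c s_def[symmetric] t_def[symmetric] using s0 by (auto simp: field_simps)
  qed
  also have "N2 = ext_norm2 (h z) (del_adj h (fund_form h) z)"
    using n by (simp add: del_adj_fund[OF z] ext_norm2_def ext_inner_minus_left ext_inner_minus_right)
      (simp add: N2_def ext_norm2_lee flip: ext_norm2_def)
  also have "N1 - cnj Q = scal h z - scal_hat h z" by (simp add: scal_diff[OF z] N1_def Q_def)
  also have "N1 = ext_norm2 (h z) (del (fund_form h) z)"
    by (simp add: N1_def del_fund[OF z] ext_norm2_tors)
  finally show ?thesis .
qed

end

section \<open>From charts to the manifold\<close>

lemma hermitian_matrixI:
  fixes H :: "'n::{finite,linorder} cmat"
  assumes herm: "\<And>i j. cnj (H $ i $ j) = H $ j $ i"
    and pos: "\<And>v. v \<noteq> 0 \<Longrightarrow> 0 < Re (\<Sum>i\<in>UNIV. \<Sum>j\<in>UNIV. H $ i $ j * v $ i * cnj (v $ j))"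
  shows "hermitian_matrix H"
proof
  show "cnj (H $ i $ j) = H $ j $ i" for i j by (rule herm)
  have "u = 0" if "H *v u = 0" for u
  proof (rule ccontr)
    assume "u \<noteq> 0"
    \<comment> \<open>The vector is conjugated because the quadratic form conjugates its second
      argument, the one contracted by \<open>H *v u\<close>.\<close>
    then have "(\<chi> i. cnj (u $ i)) \<noteq> 0" by (simp add: Finite_Cartesian_Product.vec_eq_iff)
    from pos[OF this] have "0 < Re (\<Sum>i\<in>UNIV. cnj (u $ i) * (H *v u) $ i)"
      by (simp add: matrix_vector_mult_def sum_distrib_left mult_ac)
    then show False by (simp add: that)
  qed
  then have "\<exists>B. B ** H = Finite_Cartesian_Product.mat 1" using matrix_left_invertible_ker by blast
  then show "invertible H" by (simp add: invertible_left_inverse)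
qed

theorem proposition1p7:
  fixes X :: "'a topology"
    and \<A> :: "('a, 'n::{finite,linorder}) cchart set"
    and h :: "('a, 'n) cchart \<Rightarrow> 'n cvec \<Rightarrow> 'n cmat"
    and k :: nat
  assumes "hermitian_manifold X \<A> h"
    and "3 \<le> CARD('n)"
    and "1 \<le> k" and "k \<le> CARD('n) - 1"
  shows "k_gauduchon \<A> h k \<longleftrightarrow>
    (\<forall>p\<in>topspace X. \<forall>c\<in>\<A>. p \<in> fst c \<longrightarrow>
       (let z = snd c p; \<omega> = fund_form (h c) in
        scal (h c) z - scal_hat (h c) z =
          of_real ((real k - 1) / (real CARD('n) - 2)) * ext_norm2 (h c z) (del_adj (h c) \<omega> z)
        + of_real ((real CARD('n) - 1 - real k) / (real CARD('n) - 2)) * ext_norm2 (h c z) (del \<omega> z)))"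
proof -
  have chart: "hermitian_chart (h c) (chart_image c)" if "c \<in> \<A>" for c
  proof (rule hermitian_chart.intro)
    show "open (chart_image c)" "smooth_on (h c) (chart_image c)"
      using assms(1) that
      by (auto simp: hermitian_manifold_def complex_manifold_def hermitian_metric_def is_cchart_def)
    show "hermitian_matrix (h c w)" if "w \<in> chart_image c" for w
      using assms(1) \<open>c \<in> \<A>\<close> that
      by (intro hermitian_matrixI) (auto simp: hermitian_manifold_def hermitian_metric_def)
  qed
  have sub: "p \<in> topspace X" if "c \<in> \<A>" "p \<in> fst c" for c p
    using assms(1) that by (auto simp: hermitian_manifold_def complex_manifold_def)
  have img: "(\<forall>z\<in>chart_image c. P z) \<longleftrightarrow> (\<forall>p\<in>fst c. P (snd c p))" for P and c :: "('a, 'n) cchart"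
    by (simp add: chart_image_def)
  have "k_gauduchon \<A> h k \<longleftrightarrow> (\<forall>c\<in>\<A>. \<forall>z\<in>chart_image c.
        scal (h c) z - scal_hat (h c) z =
          of_real ((real k - 1) / (real CARD('n) - 2)) * ext_norm2 (h c z) (del_adj (h c) (fund_form (h c)) z)
        + of_real ((real CARD('n) - 1 - real k) / (real CARD('n) - 2)) * ext_norm2 (h c z) (del (fund_form (h c)) z))"
    unfolding k_gauduchon_def
    by (intro ball_cong refl hermitian_chart.gauduchon_iff[OF chart _ assms(2-4)])
  then show ?thesis unfolding img Let_def using sub by blast
qed

end
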